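(* Let $\tau\in\mathbb{C}$ with $\operatorname{Im}\tau>0$, let $X_\tau=\mathbb{C}/(\mathbb{Z}+\tau\mathbb{Z})$, and let $X_{\tau,u}=X_\tau\setminus\{u\}$ for a point $u\in X_\tau$. There exists a fundamental metric $c_{\tau,u}$ on $X_{\tau,u}$, given in the local coordinate $w$ by $$c_{\tau,u}(w)|dw|^2=\frac{2\pi\,|\eta(\tau)|^3}{|\theta_1(w-u;q)|}\,|dw|^2 .$$
   Context: Points are written in the coordinate induced from $\mathbb{C}$, i.e. $z,w,u$ also denote complex numbers representing them. Set $q=\exp(\pi i\tau)$, with $q^{a}=\exp(a\pi i\tau)$; $\eta(\tau)=q^{1/12}\prod_{m=1}^\infty(1-q^{2m})$; $\theta_1(z;q)=2q^{1/4}\sin(\pi z)\prod_{n=1}^\infty(1-q^{2n})(1-2\cos(2\pi z)q^{2n}+q^{4n})$. Evans-Selberg potential: on an open Riemann surface $\Sigma$, an Evans-Selberg potential with pole $p_0\in\Sigma$ is a real-valued function $E_{p_0}(p)$ such that (i) $E_{p_0}$ is harmonic on $\Sigma\setminus\{p_0\}$; (ii) $E_{p_0}(p)\to+\infty$ as $p$ tends to the Alexandroff ideal boundary point $a_\infty$; (iii) $E_{p_0}(p)-\log|\varphi(p)-\varphi(p_0)|$ is bounded near $p_0$, with $\varphi$ a local coordinate. Fundamental metric: in the local coordinate $z=\varphi(p)$ it is $c(z)|dz|^2:=\exp\lim_{p_0\to p}\big(E_{p_0}(p)-\log|\varphi(p)-\varphi(p_0)|\big)|dz|^2$. On $X_{\tau,u}$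 the potential with pole $w$ used to form the fundamental metric is $E^{\tau,u}_w(z)=\log\left|\theta_1(z-w;q)/\theta_1(z-u;q)\right|$, so that $c_{\tau,u}(w)=\exp\lim_{z\to w}\big(E^{\tau,u}_w(z)-\log|z-w|\big)$.
   Formalization: The potential and |θ₁(w−u)| are not invariant under translation by τ, so the metric is not global: existence is shown per local coordinate, with 2π Im(w−u)Im(z−w)/Im τ added to the potential so it lives on X_{τ,u}; the limit for the original potential is also proved. *)

theory Defs
  imports "HOL-Analysis.Analysis"
begin

section \<open>Theta and eta functions\<close>

text \<open>Fractional powers of the nome are read as \<open>q\<^sup>a = exp (a \<pi> \<i> \<tau>)\<close>, so everything is a
  function of \<open>\<tau>\<close> rather than of the number \<open>q\<close>, which would not determine \<open>q\<^sup>1\<^sup>/\<^sup>4\<close>.\<close>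

definition nome_pow :: "complex \<Rightarrow> real \<Rightarrow> complex" where
  "nome_pow \<tau> a = exp (of_real (a * pi) * \<i> * \<tau>)"

definition dedekind_eta :: "complex \<Rightarrow> complex" where
  "dedekind_eta \<tau> = nome_pow \<tau> (1/12) * (\<Prod>m. 1 - nome_pow \<tau> (2 * real (Suc m)))"

definition theta1 :: "complex \<Rightarrow> complex \<Rightarrow> complex" where
  "theta1 \<tau> z = 2 * nome_pow \<tau> (1/4) * sin (of_real pi * z) *
     (\<Prod>m. (1 - nome_pow \<tau> (2 * real (Suc m))) *
          (1 - 2 * cos (2 * of_real pi * z) * nome_pow \<tau> (2 * real (Suc m))
             + nome_pow \<tau> (4 * real (Suc m))))"

section \<open>Open Riemann surfaces, Evans-Selberg potentials and fundamental metrics\<close>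

text \<open>A Riemann surface is a topological space together with an atlas, a set of pairs
  \<open>(U, \<phi>)\<close> of a domain and a local coordinate. Values of \<open>\<phi>\<close> outside \<open>U\<close> are irrelevant.\<close>

type_synonym 'p atlas = "('p set \<times> ('p \<Rightarrow> complex)) set"

definition open_riemann_surface :: "'p topology \<Rightarrow> 'p atlas \<Rightarrow> bool" where
  "open_riemann_surface X A \<longleftrightarrow>
     topspace X \<noteq> {} \<and> connected_space X \<and> Hausdorff_space X \<and> \<not> compact_space X \<and>
     (\<Union>(U, \<phi>)\<in>A. U) = topspace X \<and>
     (\<forall>(U, \<phi>)\<in>A. openin X U \<and> open (\<phi> ` U) \<and>
        homeomorphic_map (subtopology X U) (top_of_set (\<phi> ` U)) \<phi>) \<and>
     (\<forall>(U, \<phi>)\<in>A. \<forall>(V, \<psi>)\<in>A. (\<psi> \<circ> inv_into U \<phi>) holomorphic_on \<phi> ` (U \<inter> V))"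

definition harmonic_on :: "(complex \<Rightarrow> real) \<Rightarrow> complex set \<Rightarrow> bool" where
  "harmonic_on f S \<longleftrightarrow> open S \<and>
     (\<exists>fx fy fxx fxy fyx fyy.
        (\<forall>z\<in>S. (f has_derivative (\<lambda>h. fx z * Re h + fy z * Im h)) (at z) \<and>
                (fx has_derivative (\<lambda>h. fxx z * Re h + fxy z * Im h)) (at z) \<and>
                (fy has_derivative (\<lambda>h. fyx z * Re h + fyy z * Im h)) (at z) \<and>
                fxx z + fyy z = 0) \<and>
        continuous_on S fxx \<and> continuous_on S fxy \<and>
        continuous_on S fyx \<and> continuous_on S fyy)"

text \<open>The Alexandroff ideal boundary point is the point \<open>None\<close> of the one-point
  compactification. The value of a potential at its pole is irrelevant.\<close>

definition evans_selberg_potential ::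
    "'p topology \<Rightarrow> 'p atlas \<Rightarrow> 'p \<Rightarrow> ('p \<Rightarrow> real) \<Rightarrow> bool" where
  "evans_selberg_potential X A p0 E \<longleftrightarrow>
     open_riemann_surface X A \<and> p0 \<in> topspace X \<and>
     (\<forall>(U, \<phi>)\<in>A. harmonic_on (E \<circ> inv_into U \<phi>) (\<phi> ` (U - {p0}))) \<and>
     filterlim (\<lambda>x. E (the x)) at_top (atin (Alexandroff_compactification X) None) \<and>
     (\<forall>(U, \<phi>)\<in>A. p0 \<in> U \<longrightarrow>
        (\<exists>M. \<forall>\<^sub>F p in atin X p0. \<bar>E p - ln (cmod (\<phi> p - \<phi> p0))\<bar> \<le> M))"

text \<open>For a family \<open>E\<close> of potentials indexed by their poles: the limit defining the fundamental
  metric at the point \<open>p\<close> exists, and \<open>c\<close> is the density of the metric in the coordinate \<open>\<phi>\<close>.\<close>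

definition has_fundamental_density ::
    "'p topology \<Rightarrow> ('p \<Rightarrow> 'p \<Rightarrow> real) \<Rightarrow> ('p \<Rightarrow> complex) \<Rightarrow> 'p \<Rightarrow> real \<Rightarrow> bool" where
  "has_fundamental_density X E \<phi> p c \<longleftrightarrow>
     (\<exists>l. ((\<lambda>p0. E p0 p - ln (cmod (\<phi> p - \<phi> p0))) \<longlongrightarrow> l) (atin X p) \<and> c = exp l)"

section \<open>The once-punctured torus\<close>

definition torus_point :: "complex \<Rightarrow> complex \<Rightarrow> complex set" where
  "torus_point \<tau> z = {z + of_int m + of_int n * \<tau> | m n. True}"

definition torus :: "complex \<Rightarrow> complex set topology" where
  "torus \<tau> = topology (\<lambda>U. U \<subseteq> range (torus_point \<tau>) \<and> open (torus_point \<tau> -` U))"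

lemma openin_torus:
  "openin (torus \<tau>) U \<longleftrightarrow> U \<subseteq> range (torus_point \<tau>) \<and> open (torus_point \<tau> -` U)"
proof -
  let ?P = "\<lambda>U. U \<subseteq> range (torus_point \<tau>) \<and> open (torus_point \<tau> -` U)"
  have "?P (S \<inter> T)" if "?P S" "?P T" for S T
    using that unfolding vimage_Int by (blast intro: open_Int)
  moreover have "?P (\<Union>K)" if "\<forall>S\<in>K. ?P S" for K
  proof
    show "\<Union>K \<subseteq> range (torus_point \<tau>)"
      using that by blast
    show "open (torus_point \<tau> -` \<Union>K)"
      unfolding vimage_Union by (rule open_UN) (use that in blast)
  qed
  ultimately have "istopology ?P"
    unfolding istopology_def by blast
  then show ?thesis
    unfolding torus_def by (simp only: topology_inverse')
qed

lemma topspace_torus: "topspace (torus \<tau>) = range (torus_point \<tau>)"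
proof
  show "topspace (torus \<tau>) \<subseteq> range (torus_point \<tau>)"
    using openin_topspace[of "torus \<tau>"] unfolding openin_torus by blast
  have "torus_point \<tau> -` range (torus_point \<tau>) = UNIV"
    by blast
  then have "openin (torus \<tau>) (range (torus_point \<tau>))"
    unfolding openin_torus by (simp only: open_UNIV subset_refl simp_thms)
  then show "range (torus_point \<tau>) \<subseteq> topspace (torus \<tau>)"
    by (rule openin_subset)
qed

definition punctured_torus :: "complex \<Rightarrow> complex \<Rightarrow> complex set topology" where
  "punctured_torus \<tau> u =
     subtopology (torus \<tau>) (topspace (torus \<tau>) - {torus_point \<tau> u})"

text \<open>The coordinates induced from the complex plane: local inverses of the projection
  \<open>torus_point \<tau>\<close> on open sets \<open>W\<close> that embed into the punctured torus.\<close>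

definition torus_atlas :: "complex \<Rightarrow> complex \<Rightarrow> complex set atlas" where
  "torus_atlas \<tau> u =
     {(torus_point \<tau> ` W, inv_into W (torus_point \<tau>)) | W.
        open W \<and> inj_on (torus_point \<tau>) W \<and> torus_point \<tau> u \<notin> torus_point \<tau> ` W}"

definition theta_potential :: "complex \<Rightarrow> complex \<Rightarrow> complex \<Rightarrow> complex \<Rightarrow> real" where
  "theta_potential \<tau> u w z = ln (cmod (theta1 \<tau> (z - w) / theta1 \<tau> (z - u)))"

text \<open>Replacing \<open>z\<close> by \<open>z + \<tau>\<close> adds \<open>- 2 \<pi> Im (w - u)\<close> to \<open>theta_potential \<tau> u w z\<close>, which
  therefore is in general not a function on the torus. Adding the real-linear (hence harmonic)
  function of \<open>z\<close> below, which vanishes at the pole \<open>z = w\<close>, makes it doubly periodic without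
  affecting the fundamental metric.\<close>

definition periodic_theta_potential :: "complex \<Rightarrow> complex \<Rightarrow> complex \<Rightarrow> complex \<Rightarrow> real" where
  "periodic_theta_potential \<tau> u w z =
     theta_potential \<tau> u w z + 2 * pi * Im (w - u) * Im (z - w) / Im \<tau>"

end

theory Submission
  imports Defs "HOL-Complex_Analysis.Complex_Analysis"
begin

text \<open>
  Near its zero at the origin, \<open>theta1\<close> is \<open>theta1' 0 * t\<close> up to higher order, so
  \<open>theta_potential \<tau> u w z - ln (cmod (z - w))\<close> tends to \<open>ln (cmod (theta1' 0 / theta1 (w - u)))\<close> as
  \<open>z\<close> approaches \<open>w\<close>. The constant is the classical \<open>theta1' 0 = 2 \<pi> \<eta>\<^sup>3\<close>, which can be read off from
  the product: the sine has slope \<open>\<pi>\<close> there, and the remaining factors become the cube of the product in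
  \<open>\<eta>\<close> (\<open>theta1_has_field_derivative_0\<close>). Letting the pole approach a fixed point, as in the
  definition of the metric, gives the same limit.

  For the potential to live on the torus, it is written in terms of
  \<open>theta_norm \<tau> z = cmod (theta1 \<tau> z) * exp (- \<pi> (Im z)\<^sup>2 / Im \<tau>)\<close>, which is invariant under the lattice
  (\<open>theta_norm_cong\<close>). Up to an additive constant the corrected potential is
  \<open>ln (theta_norm \<tau> (z - w)) - ln (theta_norm \<tau> (z - u))\<close>, hence doubly periodic
  (\<open>periodic_theta_potential_eq_theta_norm\<close>). It is harmonic off the lattice translates of \<open>w\<close> and
  \<open>u\<close>, because there it is the logarithm of the modulus of a nonvanishing holomorphic function. It
  tends to infinity at \<open>u\<close>, where the denominator vanishes, and approaching \<open>u\<close> is the same as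
  approaching the ideal boundary because the torus is compact (\<open>torus_potential_ideal_boundary\<close>).

  The zeros of \<open>theta1\<close> are exactly the lattice points (\<open>theta1_eq_0_iff\<close>). This also
  yields the topology of the torus: two points \<open>z\<close>, \<open>w\<close> are identified iff \<open>theta1 \<tau> (z - w) = 0\<close>, a
  closed condition, which makes the quotient Hausdorff. The zero at the origin is simple, hence isolated,
  which makes the projection locally injective.
\<close>

section \<open>The product, the invariant norm and the potential on the torus\<close>

text \<open>The \<open>q\<close>-Pochhammer symbol \<open>(Q x; Q)\<^sub>\<infinity>\<close> for \<open>Q = nome_pow \<tau> 2\<close>.\<close>

definition qprod :: "complex \<Rightarrow> complex \<Rightarrow> complex" where
  "qprod \<tau> x = (\<Prod>m. 1 - nome_pow \<tau> (2 * real (Suc m)) * x)"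

text \<open>The Gaussian weight exactly cancels the growth of \<open>theta1\<close> under translation by \<open>\<tau>\<close>: this is the
  norm of \<open>theta1\<close> as a section of a line bundle on the torus with a metric of constant curvature.\<close>

definition theta_norm :: "complex \<Rightarrow> complex \<Rightarrow> real" where
  "theta_norm \<tau> z = cmod (theta1 \<tau> z) * exp (- (pi * (Im z)\<^sup>2 / Im \<tau>))"

text \<open>The choice of a representative by \<open>inv\<close> is immaterial away from the pole and the puncture, where the
  potential is doubly periodic.\<close>

definition torus_potential :: "complex \<Rightarrow> complex \<Rightarrow> complex \<Rightarrow> complex set \<Rightarrow> real" where
  "torus_potential \<tau> u w p = periodic_theta_potential \<tau> u w (inv (torus_point \<tau>) p)"

section \<open>Lattice translations\<close>

lemma mem_torus_point: "z \<in> torus_point \<tau> w \<longleftrightarrow> (\<exists>m n. z = w + of_int m + of_int n * \<tau>)"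
  by (auto simp: torus_point_def)

lemma torus_point_eq_iff:
  "torus_point \<tau> z = torus_point \<tau> w \<longleftrightarrow> (\<exists>m n. z = w + of_int m + of_int n * \<tau>)"
proof
  assume "torus_point \<tau> z = torus_point \<tau> w"
  moreover have "z \<in> torus_point \<tau> z"
    unfolding mem_torus_point by (intro exI[of _ 0]) simp
  ultimately show "\<exists>m n. z = w + of_int m + of_int n * \<tau>"
    by (simp add: mem_torus_point)
next
  assume "\<exists>m n. z = w + of_int m + of_int n * \<tau>"
  then obtain m n where z: "z = w + of_int m + of_int n * \<tau>"
    by blast
  have "\<exists>m n. x = w + of_int m + of_int n * \<tau>" if "x = z + of_int m' + of_int n' * \<tau>" for x m' n'
    using that z by (intro exI[of _ "m + m'"] exI[of _ "n + n'"]) (simp add: algebra_simps)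
  moreover have "\<exists>m n. x = z + of_int m + of_int n * \<tau>" if "x = w + of_int m' + of_int n' * \<tau>" for x m' n'
    using that z by (intro exI[of _ "m' - m"] exI[of _ "n' - n"]) (simp add: algebra_simps)
  ultimately show "torus_point \<tau> z = torus_point \<tau> w"
    by (auto simp: set_eq_iff mem_torus_point)
qed

lemma torus_point_diff_eq_iff:
  "torus_point \<tau> (z - w) = torus_point \<tau> 0 \<longleftrightarrow> torus_point \<tau> z = torus_point \<tau> w"
  unfolding torus_point_eq_iff by (simp add: algebra_simps)

lemma periodic_of_int:
  fixes f :: "complex \<Rightarrow> 'a"
  assumes "\<And>z. f (z + c) = f z"
  shows "f (z + of_int n * c) = f z"
proof (induction n rule: int_induct[of _ 0])
  case (step1 i)
  then show ?case
    using assms[of "z + of_int i * c"] by (simp add: algebra_simps)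
next
  case (step2 i)
  then show ?case
    using assms[of "z + of_int (i - 1) * c"] by (simp add: algebra_simps)
qed simp

section \<open>Harmonicity of logarithms of moduli\<close>

lemma harmonic_on_cong:
  assumes f: "harmonic_on f S" and eq: "\<And>z. z \<in> S \<Longrightarrow> f z = g z"
  shows "harmonic_on g S"
proof -
  have "(g has_derivative D) (at z)" if "(f has_derivative D) (at z)" "z \<in> S" for D z
    using has_derivative_transform_within_open[OF that(1) _ that(2)] f eq by (auto simp: harmonic_on_def)
  then show ?thesis
    using f unfolding harmonic_on_def by meson
qed

text \<open>Locally this is the real part of a branch of the logarithm of \<open>F\<close>. The partial derivatives
  come from the logarithmic derivative, which needs no branch.\<close>

lemma harmonic_on_ln_cmod:
  assumes S: "open S" and F: "F holomorphic_on S" and nz: "\<And>z. z \<in> S \<Longrightarrow> F z \<noteq> 0"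
  shows "harmonic_on (\<lambda>z. ln (cmod (F z))) S"
proof -
  \<comment> \<open>The gradient of \<open>ln (cmod F)\<close> is the conjugate of the logarithmic derivative \<open>G\<close>, so
    \<open>Re G\<close> and \<open>- Im G\<close> are the first partial derivatives of \<open>ln (cmod F)\<close>.\<close>
  define G where "G z = deriv F z / F z" for z
  have G: "G holomorphic_on S"
    unfolding G_def using S F nz by (intro holomorphic_intros) auto
  then have G': "deriv G holomorphic_on S"
    using S by (intro holomorphic_deriv)
  have cont: "continuous_on S (deriv G)"
    using G' by (rule holomorphic_on_imp_continuous_on)
  have f: "((\<lambda>z. ln (cmod (F z))) has_derivative (\<lambda>h. Re (G z) * Re h + - Im (G z) * Im h)) (at z)"
    if z: "z \<in> S" for z
  proof -
    have "(F has_derivative (\<lambda>h. deriv F z * h)) (at z)"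
      using holomorphic_derivI[OF F S z] by (simp add: has_field_derivative_def)
    then have "((\<lambda>z. cmod (F z)) has_derivative (\<lambda>h. (deriv F z * h) \<bullet> sgn (F z))) (at z)"
      using has_derivative_norm[OF nz[OF z]] by (rule has_derivative_compose)
    then have "((\<lambda>z. ln (cmod (F z))) has_derivative
        (\<lambda>h. inverse (cmod (F z)) * ((deriv F z * h) \<bullet> sgn (F z)))) (at z)"
      using nz[OF z] by (auto intro!: derivative_eq_intros simp: field_simps)
    moreover have "inverse (cmod (F z)) * ((deriv F z * h) \<bullet> sgn (F z)) = Re (G z) * Re h + - Im (G z) * Im h" for h
    proof -
      have "inverse (cmod (F z)) * (v \<bullet> sgn (F z)) = Re (v / F z)" for v
      proof -
        have "Re (v / F z) = Re (v * cnj (F z)) / (cmod (F z))\<^sup>2"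
          by (metis Re_divide_of_real complex_div_cnj of_real_power)
        then show ?thesis
          by (simp add: inner_complex_def sgn_div_norm divide_inverse power2_eq_square ring_distribs mult_ac)
      qed
      then have "inverse (cmod (F z)) * ((deriv F z * h) \<bullet> sgn (F z)) = Re (deriv F z * h / F z)" .
      also have "deriv F z * h / F z = G z * h"
        by (simp add: G_def)
      finally show ?thesis
        by simp
    qed
    ultimately show ?thesis
      by simp
  qed
  have dG: "(G has_derivative (\<lambda>h. deriv G z * h)) (at z)" if "z \<in> S" for z
    using holomorphic_derivI[OF G S that] by (simp add: has_field_derivative_def)
  have re: "((\<lambda>z. Re (G z)) has_derivative (\<lambda>h. Re (deriv G z) * Re h + - Im (deriv G z) * Im h)) (at z)"
    if "z \<in> S" for z
    using has_derivative_Re[OF dG[OF that]] by simp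
  have im: "((\<lambda>z. - Im (G z)) has_derivative (\<lambda>h. - Im (deriv G z) * Re h + - Re (deriv G z) * Im h)) (at z)"
    if "z \<in> S" for z
    using has_derivative_minus[OF has_derivative_Im[OF dG[OF that]]] by (simp add: algebra_simps)
  show ?thesis
    unfolding harmonic_on_def
  proof (rule conjI[OF S], rule exI[of _ "\<lambda>z. Re (G z)"], rule exI[of _ "\<lambda>z. - Im (G z)"],
      rule exI[of _ "\<lambda>z. Re (deriv G z)"], rule exI[of _ "\<lambda>z. - Im (deriv G z)"],
      rule exI[of _ "\<lambda>z. - Im (deriv G z)"], rule exI[of _ "\<lambda>z. - Re (deriv G z)"], intro conjI ballI)
    show "continuous_on S (\<lambda>z. Re (deriv G z))" "continuous_on S (\<lambda>z. - Re (deriv G z))"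
      "continuous_on S (\<lambda>z. - Im (deriv G z))" "continuous_on S (\<lambda>z. - Im (deriv G z))"
      by (intro continuous_intros cont)+
  qed (use f re im in auto)
qed

section \<open>The projection to the torus and its charts\<close>

text \<open>The saturation of \<open>W\<close> is the union of its lattice translates.\<close>

lemma open_vimage_torus_point_image:
  assumes "open W"
  shows "open (torus_point \<tau> -` torus_point \<tau> ` W)"
proof -
  have "z \<in> torus_point \<tau> -` torus_point \<tau> ` W \<longleftrightarrow> (\<exists>m n. z - (of_int m + of_int n * \<tau>) \<in> W)" for z
  proof -
    have "z \<in> torus_point \<tau> -` torus_point \<tau> ` W \<longleftrightarrow> (\<exists>w\<in>W. \<exists>m n. w = z - (of_int m + of_int n * \<tau>))"
      by (simp add: image_iff torus_point_eq_iff eq_diff_eq add.assoc eq_commute[of z])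
    then show ?thesis
      by blast
  qed
  then have "torus_point \<tau> -` torus_point \<tau> ` W = (\<Union>m n. (\<lambda>z. z - (of_int m + of_int n * \<tau>)) -` W)"
    by (simp add: set_eq_iff)
  also have "open \<dots>"
    using assms by (intro open_UN ballI open_vimage continuous_intros)
  finally show ?thesis .
qed

lemma open_map_torus_point: "open_map euclidean (torus \<tau>) (torus_point \<tau>)"
  by (auto simp: open_map_def openin_torus open_vimage_torus_point_image)

lemma continuous_map_torus_point: "continuous_map euclidean (torus \<tau>) (torus_point \<tau>)"
  by (auto simp: continuous_map_def topspace_torus openin_torus vimage_def)

lemma topspace_punctured_torus:
  "topspace (punctured_torus \<tau> u) = torus_point \<tau> ` {z. torus_point \<tau> z \<noteq> torus_point \<tau> u}"
  by (auto simp: punctured_torus_def topspace_torus)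

lemma torus_point_mem_punctured_torus:
  "torus_point \<tau> z \<in> topspace (punctured_torus \<tau> u) \<longleftrightarrow> torus_point \<tau> z \<noteq> torus_point \<tau> u"
  by (auto simp: topspace_punctured_torus)

lemma torus_atlasE:
  assumes "(U, \<phi>) \<in> torus_atlas \<tau> u"
  obtains W where "open W" "inj_on (torus_point \<tau>) W" "U = torus_point \<tau> ` W"
    "\<And>z. z \<in> W \<Longrightarrow> torus_point \<tau> z \<noteq> torus_point \<tau> u"
    "\<And>z. z \<in> W \<Longrightarrow> \<phi> (torus_point \<tau> z) = z"
    "\<And>z. z \<in> W \<Longrightarrow> inv_into U \<phi> z = torus_point \<tau> z"
proof -
  obtain W where W: "open W" "inj_on (torus_point \<tau>) W" "torus_point \<tau> u \<notin> torus_point \<tau> ` W"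
    and U: "U = torus_point \<tau> ` W" and \<phi>: "\<phi> = inv_into W (torus_point \<tau>)"
    using assms by (auto simp: torus_atlas_def)
  have *: "\<phi> (torus_point \<tau> z) = z" if "z \<in> W" for z
    using W(2) that by (simp add: \<phi>)
  then have "inj_on \<phi> U"
    by (auto simp: U inj_on_def)
  then have "inv_into U \<phi> z = torus_point \<tau> z" if "z \<in> W" for z
    using that * by (intro inv_into_f_eq) (auto simp: U)
  moreover have "torus_point \<tau> z \<noteq> torus_point \<tau> u" if "z \<in> W" for z
    using W(3) that by (metis imageI)
  ultimately show thesis
    using that W U * by blast
qed

text \<open>Two lifts of the same point differ by a lattice point. The charts are injective with open images, so
  the difference is locally constant and the transition map is locally a translation.\<close>

lemma torus_transition_holomorphic:
  assumes "(U, \<phi>) \<in> torus_atlas \<tau> u" "(V, \<psi>) \<in> torus_atlas \<tau> u"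
  shows "(\<psi> \<circ> inv_into U \<phi>) holomorphic_on \<phi> ` (U \<inter> V)"
proof -
  obtain W where W: "open W" "U = torus_point \<tau> ` W" "\<And>z. z \<in> W \<Longrightarrow> \<phi> (torus_point \<tau> z) = z"
      "\<And>z. z \<in> W \<Longrightarrow> inv_into U \<phi> z = torus_point \<tau> z"
    using assms(1) by (rule torus_atlasE) blast
  obtain W' where W': "open W'" "V = torus_point \<tau> ` W'" "\<And>z. z \<in> W' \<Longrightarrow> \<psi> (torus_point \<tau> z) = z"
    using assms(2) by (rule torus_atlasE) blast
  have "(\<psi> \<circ> inv_into U \<phi>) field_differentiable (at z within \<phi> ` (U \<inter> V))" if "z \<in> \<phi> ` (U \<inter> V)" for z
  proof -
    obtain z' where z: "z \<in> W" and z': "z' \<in> W'" and eq: "torus_point \<tau> z' = torus_point \<tau> z"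
      using \<open>z \<in> \<phi> ` (U \<inter> V)\<close> W(2,3) W'(2) by force
    define S where "S = W \<inter> (+) (z' - z) -` W'"
    have "open S"
      unfolding S_def using W(1) W'(1) by (intro open_Int open_vimage continuous_intros)
    moreover have "z \<in> S"
      using z z' by (simp add: S_def)
    moreover have "y + (z' - z) = (\<psi> \<circ> inv_into U \<phi>) y" if "y \<in> S" for y
    proof -
      have "torus_point \<tau> (y + (z' - z)) = torus_point \<tau> y"
        using eq unfolding torus_point_eq_iff by (simp add: algebra_simps)
      then show ?thesis
        using that W(4)[of y] W'(3)[of "y + (z' - z)"] by (simp add: S_def add.commute)
    qed
    moreover have "((\<lambda>y. y + (z' - z)) has_field_derivative 1) (at z)"
      by (auto intro!: derivative_eq_intros)
    ultimately have "((\<psi> \<circ> inv_into U \<phi>) has_field_derivative 1) (at z)"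
      using has_field_derivative_transform_within_open by blast
    then show ?thesis
      using field_differentiable_at_within field_differentiable_def by blast
  qed
  then show ?thesis
    by (simp add: holomorphic_on_def)
qed

section \<open>The theta function as an entire function\<close>

lemma theta_norm_eq_0_iff: "theta_norm \<tau> z = 0 \<longleftrightarrow> theta1 \<tau> z = 0"
  by (simp add: theta_norm_def)

lemma nome_pow_even: "nome_pow \<tau> (2 * real n) = nome_pow \<tau> 2 ^ n"
  by (simp add: nome_pow_def flip: exp_of_nat_mult) (simp add: algebra_simps)

lemma nome_pow_add: "nome_pow \<tau> (a + b) = nome_pow \<tau> a * nome_pow \<tau> b"
  by (simp add: nome_pow_def algebra_simps flip: exp_add)

lemma nome_pow_nonzero: "nome_pow \<tau> a \<noteq> 0"
  by (simp add: nome_pow_def)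

lemma filterlim_diff_at: "filterlim (\<lambda>z. z - a) (at 0) (at a)"
  for a :: complex
  by (simp add: filterlim_at eventually_at_filter tendsto_intros LIM_zero)

context
  fixes \<tau> :: complex
  assumes Im_tau: "Im \<tau> > 0"
begin

lemma norm_nome_pow_less_1: "cmod (nome_pow \<tau> 2) < 1"
  using Im_tau by (simp add: nome_pow_def)

lemma has_prod_qprod: "(\<lambda>m. 1 - nome_pow \<tau> (2 * real (Suc m)) * x) has_prod qprod \<tau> x"
proof -
  have "summable (\<lambda>m. cmod (nome_pow \<tau> 2) ^ Suc m * cmod x)"
    using norm_nome_pow_less_1 by (intro summable_mult2) (simp add: summable_geometric)
  then have "abs_convergent_prod (\<lambda>m. 1 - nome_pow \<tau> (2 * real (Suc m)) * x)"
    by (intro summable_imp_abs_convergent_prod) (simp only: nome_pow_even, simp add: norm_mult norm_power)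
  then show ?thesis
    unfolding qprod_def using abs_convergent_prod_imp_convergent_prod convergent_prod_has_prod by blast
qed

text \<open>The sum of \<open>cmod (f\<^sub>m x - 1)\<close> over the factors \<open>f\<^sub>m\<close> is dominated by a geometric series uniformly on
  discs, so the partial products converge locally uniformly.\<close>

lemma qprod_holomorphic: "qprod \<tau> holomorphic_on UNIV"
proof (rule holomorphic_uniform_sequence)
  let ?f = "\<lambda>m x. 1 - nome_pow \<tau> (2 * real (Suc m)) * x"
  let ?P = "\<lambda>N x. \<Prod>m<N. ?f m x"
  show "\<exists>d>0. cball x d \<subseteq> UNIV \<and> uniform_limit (cball x d) ?P (qprod \<tau>) sequentially" for x
  proof (intro exI conjI)
    have bound: "norm (norm (?f m y - 1)) \<le> cmod (nome_pow \<tau> 2) ^ Suc m * (cmod x + 1)"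
      if "y \<in> cball x 1" for m y
    proof -
      have "cmod y \<le> cmod x + 1"
        using that norm_triangle_ineq2[of y x] by (simp add: dist_norm norm_minus_commute)
      then have "cmod (nome_pow \<tau> 2) ^ Suc m * cmod y \<le> cmod (nome_pow \<tau> 2) ^ Suc m * (cmod x + 1)"
        by (intro mult_left_mono) auto
      then show ?thesis
        by (simp only: nome_pow_even) (simp add: norm_mult norm_power)
    qed
    have "summable (\<lambda>m. cmod (nome_pow \<tau> 2) ^ Suc m * (cmod x + 1))"
      using norm_nome_pow_less_1 by (intro summable_mult2) (simp add: summable_geometric)
    then have "uniformly_convergent_on (cball x 1) (\<lambda>N y. \<Sum>m<N. norm (?f m y - 1))"
      by (rule Weierstrass_m_test'[rotated]) (rule bound)
    then have "uniformly_convergent_on (cball x 1) ?P"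
      by (intro uniformly_convergent_on_prod') (auto intro!: continuous_intros)
    then have lim: "uniform_limit (cball x 1) ?P (\<lambda>y. lim (\<lambda>n. ?P n y)) sequentially"
      by (simp only: uniformly_convergent_uniform_limit_iff)
    have "lim (\<lambda>n. ?P n y) = qprod \<tau> y" for y
    proof -
      have "(\<lambda>n. ?P (Suc n) y) \<longlonglongrightarrow> qprod \<tau> y"
        using convergent_prod_LIMSEQ[of "\<lambda>m. ?f m y"] has_prod_qprod[of y]
        unfolding lessThan_Suc_atMost by (simp only: has_prod_iff)
      then show ?thesis
        by (intro limI) (rule LIMSEQ_imp_Suc)
    qed
    with lim show "uniform_limit (cball x 1) ?P (qprod \<tau>) sequentially"
      by simp
  qed auto
qed (auto intro!: holomorphic_intros)

lemma qprod_eq_0_iff: "qprod \<tau> x = 0 \<longleftrightarrow> (\<exists>n. nome_pow \<tau> (2 * real (Suc n)) * x = 1)"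
  using has_prod_eq_0_iff[OF has_prod_qprod[of x]] by (auto simp: image_iff)

lemma qprod_1_nonzero: "qprod \<tau> 1 \<noteq> 0"
proof
  assume "qprod \<tau> 1 = 0"
  then obtain n where "nome_pow \<tau> 2 ^ Suc n = 1"
    unfolding qprod_eq_0_iff nome_pow_even by auto
  then have "cmod (nome_pow \<tau> 2) ^ Suc n = 1"
    by (metis norm_one norm_power)
  moreover have "cmod (nome_pow \<tau> 2) ^ Suc n < 1"
    using norm_nome_pow_less_1 by (intro power_Suc_less_one) (auto simp: nome_pow_nonzero)
  ultimately show False
    by simp
qed

text \<open>The products at \<open>x\<close> and \<open>nome_pow \<tau> 2 * x\<close> have the same factors up to the first one. This is
  the source of the quasi-periodicity of \<open>theta1\<close>.\<close>

lemma qprod_shift: "qprod \<tau> x = (1 - nome_pow \<tau> 2 * x) * qprod \<tau> (nome_pow \<tau> 2 * x)"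
proof -
  let ?f = "\<lambda>m. 1 - nome_pow \<tau> (2 * real (Suc m)) * x"
  \<comment> \<open>Multiplying the first factor back in, instead of dividing by it, covers the case that it vanishes.\<close>
  have "?f has_prod ((\<Prod>k<1. ?f k) * (\<Prod>k. ?f (k + 1)))"
    using has_prod_qprod[of x] by (intro has_prod_ignore_initial_segment') (simp only: has_prod_iff)
  then have "qprod \<tau> x = (\<Prod>k<1. ?f k) * (\<Prod>k. ?f (k + 1))"
    using has_prod_qprod[of x] has_prod_unique2 by blast
  moreover have "nome_pow \<tau> (2 * real (Suc (k + 1))) = nome_pow \<tau> (2 * real (Suc k)) * nome_pow \<tau> 2" for k
    by (simp add: algebra_simps flip: nome_pow_add)
  ultimately show ?thesis
    unfolding qprod_def by (simp add: mult.assoc)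
qed

lemma dedekind_eta_eq_qprod: "dedekind_eta \<tau> = nome_pow \<tau> (1/12) * qprod \<tau> 1"
  by (simp add: dedekind_eta_def qprod_def)

lemma dedekind_eta_nonzero: "dedekind_eta \<tau> \<noteq> 0"
  by (simp add: dedekind_eta_eq_qprod qprod_1_nonzero nome_pow_nonzero)

text \<open>With \<open>e = exp (2 \<pi> \<i> z)\<close>, each factor \<open>1 - 2 cos (2 \<pi> z) Q + Q\<^sup>2\<close> splits as
  \<open>(1 - Q e) (1 - Q / e)\<close>. In this form convergence, zeros and translations reduce to those of
  \<open>qprod\<close>.\<close>

lemma theta1_eq_qprod:
  "theta1 \<tau> z = 2 * nome_pow \<tau> (1/4) * sin (of_real pi * z) *
     (qprod \<tau> 1 * qprod \<tau> (exp (2 * of_real pi * \<i> * z)) * qprod \<tau> (exp (- (2 * of_real pi * \<i> * z))))"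
proof -
  let ?e = "exp (2 * of_real pi * \<i> * z)" and ?e' = "exp (- (2 * of_real pi * \<i> * z))"
  have cos: "2 * cos (2 * of_real pi * z) = ?e + ?e'"
    by (simp add: cos_exp_eq algebra_simps)
  have inv: "?e * ?e' = 1"
    by (simp flip: exp_add)
  have factor: "(1 - Q * 1) * (1 - Q * ?e) * (1 - Q * ?e') =
      (1 - Q) * (1 - 2 * cos (2 * of_real pi * z) * Q + Q * Q)" for Q
  proof -
    have "(1 - Q * ?e) * (1 - Q * ?e') = 1 - (?e + ?e') * Q + Q * Q * (?e * ?e')"
      by algebra
    then show ?thesis
      unfolding cos inv by (simp only: mult_1_right mult.assoc)
  qed
  have four: "nome_pow \<tau> (4 * real (Suc m)) = nome_pow \<tau> (2 * real (Suc m)) * nome_pow \<tau> (2 * real (Suc m))" for m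
    by (simp add: algebra_simps flip: nome_pow_add)
  have "(\<lambda>m. (1 - nome_pow \<tau> (2 * real (Suc m)) * 1) * (1 - nome_pow \<tau> (2 * real (Suc m)) * ?e)
           * (1 - nome_pow \<tau> (2 * real (Suc m)) * ?e')) has_prod (qprod \<tau> 1 * qprod \<tau> ?e * qprod \<tau> ?e')"
    by (intro has_prod_mult has_prod_qprod)
  then have "(\<Prod>m. (1 - nome_pow \<tau> (2 * real (Suc m))) *
          (1 - 2 * cos (2 * of_real pi * z) * nome_pow \<tau> (2 * real (Suc m))
             + nome_pow \<tau> (4 * real (Suc m)))) = qprod \<tau> 1 * qprod \<tau> ?e * qprod \<tau> ?e'"
    unfolding factor four by (rule has_prod_unique[symmetric])
  then show ?thesis
    unfolding theta1_def by simp
qed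

lemma theta1_holomorphic:
  assumes "f holomorphic_on A"
  shows "(\<lambda>z. theta1 \<tau> (f z)) holomorphic_on A"
proof -
  have q: "(\<lambda>z. qprod \<tau> (g z)) holomorphic_on A" if "g holomorphic_on A" for g
    using holomorphic_on_compose_gen[OF that qprod_holomorphic] by (simp add: o_def)
  show ?thesis
    unfolding theta1_eq_qprod by (intro holomorphic_intros q assms)
qed

lemma theta1_continuous:
  assumes "continuous_on A f"
  shows "continuous_on A (\<lambda>z. theta1 \<tau> (f z))"
  using continuous_on_compose2[OF holomorphic_on_imp_continuous_on[OF theta1_holomorphic[OF holomorphic_on_ident]] assms]
  by auto

lemma theta1_tendsto:
  assumes "(f \<longlongrightarrow> a) F"
  shows "((\<lambda>z. theta1 \<tau> (f z)) \<longlongrightarrow> theta1 \<tau> a) F"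
proof -
  have "isCont (theta1 \<tau>) a"
    using theta1_continuous[of UNIV "\<lambda>z. z"] by (simp add: continuous_on_eq_continuous_at)
  then show ?thesis
    using assms isCont_tendsto_compose by blast
qed

lemma theta1_0: "theta1 \<tau> 0 = 0"
  by (simp add: theta1_def)

text \<open>The sine contributes \<open>\<pi>\<close>, and at \<open>0\<close> all three products equal the one in \<open>dedekind_eta\<close>. The
  fractional powers agree since \<open>1/4 = 3 * (1/12)\<close>. This is the constant in the metric.\<close>

lemma theta1_has_field_derivative_0:
  "(theta1 \<tau> has_field_derivative 2 * of_real pi * dedekind_eta \<tau> ^ 3) (at 0)"
proof -
  define g where "g z = 2 * nome_pow \<tau> (1/4) *
     (qprod \<tau> 1 * qprod \<tau> (exp (2 * of_real pi * \<i> * z)) * qprod \<tau> (exp (- (2 * of_real pi * \<i> * z))))" for z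
  have q: "(\<lambda>z. qprod \<tau> (h z)) holomorphic_on UNIV" if "h holomorphic_on UNIV" for h
    using holomorphic_on_compose_gen[OF that qprod_holomorphic] by (simp add: o_def)
  have "g holomorphic_on UNIV"
    unfolding g_def by (intro holomorphic_intros q)
  then have g: "(g has_field_derivative deriv g 0) (at 0)"
    by (rule holomorphic_derivI) auto
  have "((\<lambda>z. sin (of_real pi * z) * g z) has_field_derivative of_real pi * g 0) (at 0)"
    by (rule derivative_eq_intros g refl | simp)+
  moreover have "theta1 \<tau> = (\<lambda>z. sin (of_real pi * z) * g z)"
    by (simp add: fun_eq_iff theta1_eq_qprod g_def)
  moreover have "nome_pow \<tau> (1/4) = nome_pow \<tau> (1/12) ^ 3"
    by (simp add: power3_eq_cube flip: nome_pow_add)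
  ultimately show ?thesis
    by (simp add: g_def dedekind_eta_eq_qprod power3_eq_cube mult_ac)
qed

section \<open>Quasi-periodicity and zeros of the theta function\<close>

lemma theta1_add_1: "theta1 \<tau> (z + 1) = - theta1 \<tau> z"
proof -
  have "sin (of_real pi * (z + 1)) = - sin (of_real pi * z)"
    by (simp add: ring_distribs sin_add flip: sin_of_real cos_of_real)
  moreover have "exp (2 * of_real pi * \<i> * (z + 1)) = exp (2 * of_real pi * \<i> * z)"
    "exp (- (2 * of_real pi * \<i> * (z + 1))) = exp (- (2 * of_real pi * \<i> * z))"
    by (simp_all add: ring_distribs exp_add exp_diff exp_minus)
  ultimately show ?thesis
    unfolding theta1_eq_qprod by simp
qed

text \<open>Translation by \<open>\<tau>\<close> multiplies \<open>exp (2 \<pi> \<i> z)\<close> by \<open>nome_pow \<tau> 2\<close>, so one product loses its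
  first factor and the other one gains a factor. These two exchange the sine at \<open>z + \<tau>\<close> for
  the one at \<open>z\<close>, up to an exponential.\<close>

lemma theta1_add_tau:
  "theta1 \<tau> (z + \<tau>) = - exp (- (of_real pi * \<i> * \<tau>)) * exp (- (2 * of_real pi * \<i> * z)) * theta1 \<tau> z"
proof -
  define s where "s = exp (of_real pi * \<i> * z)"
  define t where "t = exp (of_real pi * \<i> * \<tau>)"
  have nz: "s \<noteq> 0" "t \<noteq> 0"
    by (auto simp: s_def t_def)
  have t2: "nome_pow \<tau> 2 = t\<^sup>2"
    by (simp add: nome_pow_def t_def mult_ac flip: exp_double)
  have e1: "exp (2 * of_real pi * \<i> * z) = s\<^sup>2" and e2: "exp (2 * of_real pi * \<i> * (z + \<tau>)) = t\<^sup>2 * s\<^sup>2"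
    by (simp_all add: s_def t_def power2_eq_square algebra_simps flip: exp_add)
  note e = exp_minus e1 e2 t_def[symmetric]
  have sin1: "sin (of_real pi * z) = (s - inverse s) / (2 * \<i>)"
    by (simp add: sin_exp_eq s_def mult_ac flip: exp_minus)
  have sin2: "sin (of_real pi * (z + \<tau>)) = (t * s - inverse (t * s)) / (2 * \<i>)"
    by (simp add: sin_exp_eq s_def t_def ring_distribs exp_add exp_diff exp_minus field_simps)
  have q1: "qprod \<tau> (s\<^sup>2) = (1 - t\<^sup>2 * s\<^sup>2) * qprod \<tau> (t\<^sup>2 * s\<^sup>2)"
    using qprod_shift[of "s\<^sup>2"] by (simp add: t2)
  have q2: "qprod \<tau> (inverse (t\<^sup>2 * s\<^sup>2)) = (1 - inverse (s\<^sup>2)) * qprod \<tau> (inverse (s\<^sup>2))"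
  proof -
    have "t\<^sup>2 * inverse (t\<^sup>2 * s\<^sup>2) = inverse (s\<^sup>2)"
      using nz by (simp add: field_simps)
    then show ?thesis
      using qprod_shift[of "inverse (t\<^sup>2 * s\<^sup>2)"] by (simp only: t2)
  qed
  \<comment> \<open>Here \<open>a\<close>, \<open>c\<close> are the sine factors at \<open>z + \<tau>\<close> and \<open>z\<close>, and \<open>b\<close>, \<open>d\<close> the factors that the two
    products gain and lose; \<open>x\<close>, \<open>y\<close> are the exponentials, and everything else is common to both sides.\<close>
  have regroup: "2 * N * (a / (2 * \<i>)) * (p * Q * (b * r)) =
      - x * y * (2 * N * (c / (2 * \<i>)) * (p * (d * Q) * r))"
    if "a * b = - (x * y) * (c * d)" for N a b c d p Q r x y
  proof -
    have "2 * N * (a / (2 * \<i>)) * (p * Q * (b * r)) = (a * b) * (N * p * Q * r / \<i>)"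
      by simp
    also have "\<dots> = - (x * y) * (c * d) * (N * p * Q * r / \<i>)"
      by (simp only: that)
    also have "\<dots> = - x * y * (2 * N * (c / (2 * \<i>)) * (p * (d * Q) * r))"
      by simp
    finally show ?thesis .
  qed
  have "(t * s - inverse (t * s)) * (1 - inverse (s\<^sup>2)) =
      - (inverse t * inverse (s\<^sup>2)) * ((s - inverse s) * (1 - t\<^sup>2 * s\<^sup>2))"
    using nz by (simp add: field_simps power2_eq_square)
  then show ?thesis
    unfolding theta1_eq_qprod e sin1 sin2 q1 q2 by (rule regroup)
qed

text \<open>It suffices to check the two generators of the lattice. For \<open>\<tau>\<close> the exponents cancel on completing
  the square of \<open>Im (z + \<tau>)\<close>.\<close>

lemma theta_norm_cong:
  assumes "torus_point \<tau> z = torus_point \<tau> w"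
  shows "theta_norm \<tau> z = theta_norm \<tau> w"
proof -
  have one: "theta_norm \<tau> (z + 1) = theta_norm \<tau> z" for z
    by (simp add: theta_norm_def theta1_add_1)
  have tau: "theta_norm \<tau> (z + \<tau>) = theta_norm \<tau> z" for z
  proof -
    have "cmod (theta1 \<tau> (z + \<tau>)) = exp (pi * Im \<tau> + 2 * pi * Im z) * cmod (theta1 \<tau> z)"
      by (simp add: theta1_add_tau norm_mult exp_add)
    moreover have "pi * Im \<tau> + 2 * pi * Im z - pi * (Im (z + \<tau>))\<^sup>2 / Im \<tau> = - (pi * (Im z)\<^sup>2 / Im \<tau>)"
      using Im_tau by (simp add: field_simps power2_eq_square)
    ultimately show ?thesis
      by (simp add: theta_norm_def mult.commute mult.left_commute flip: exp_add)
  qed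
  obtain m n where "z = w + of_int m * 1 + of_int n * \<tau>"
    using assms by (auto simp: torus_point_eq_iff)
  then show ?thesis
    by (simp only: periodic_of_int[of "theta_norm \<tau>", OF one] periodic_of_int[of "theta_norm \<tau>", OF tau])
qed

text \<open>Lattice points are zeros by periodicity of the norm, as \<open>0\<close> is one. Conversely, a vanishing sine makes
  \<open>z\<close> an integer, and a vanishing factor of a product makes \<open>n \<tau> + z\<close> or \<open>n \<tau> - z\<close> an integer.\<close>

lemma theta1_eq_0_iff: "theta1 \<tau> z = 0 \<longleftrightarrow> torus_point \<tau> z = torus_point \<tau> 0"
proof
  assume "torus_point \<tau> z = torus_point \<tau> 0"
  then show "theta1 \<tau> z = 0"
    using theta_norm_cong[of z 0] theta1_0 by (simp flip: theta_norm_eq_0_iff)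
next
  assume "theta1 \<tau> z = 0"
  then consider "sin (of_real pi * z) = 0" | "qprod \<tau> (exp (2 * of_real pi * \<i> * z)) = 0"
    | "qprod \<tau> (exp (- (2 * of_real pi * \<i> * z))) = 0"
    by (auto simp: theta1_eq_qprod nome_pow_nonzero qprod_1_nonzero)
  moreover have exp_case: "\<exists>m::int. of_nat (Suc n) * \<tau> + x = of_int m"
    if "nome_pow \<tau> (2 * real (Suc n)) * exp (2 * of_real pi * \<i> * x) = 1" for n x
  proof -
    have "exp (2 * of_real pi * \<i> * (of_nat (Suc n) * \<tau> + x)) = 1"
      using that by (simp add: nome_pow_def algebra_simps flip: exp_add)
    then obtain m :: int where m: "Re (2 * of_real pi * \<i> * (of_nat (Suc n) * \<tau> + x)) = 0"
      "Im (2 * of_real pi * \<i> * (of_nat (Suc n) * \<tau> + x)) = of_int (2 * m) * pi"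
      unfolding exp_eq_1 by blast
    then have "of_nat (Suc n) * \<tau> + x = of_int m"
      by (auto simp: complex_eq_iff)
    then show ?thesis ..
  qed
  ultimately have "\<exists>m n. z = of_int m + of_int n * \<tau>"
  proof cases
    case 1
    then obtain m :: int where "of_real pi * z = of_real (of_int m * pi)"
      unfolding sin_eq_0 by blast
    then have "z = of_int m"
      by simp
    then show ?thesis
      by (intro exI[of _ m] exI[of _ 0]) simp
  next
    case 2
    then obtain n and m :: int where "of_nat (Suc n) * \<tau> + z = of_int m"
      unfolding qprod_eq_0_iff using exp_case by blast
    then show ?thesis
      by (intro exI[of _ m] exI[of _ "- int (Suc n)"]) (simp add: algebra_simps)
  next
    case 3
    then obtain n where "nome_pow \<tau> (2 * real (Suc n)) * exp (2 * of_real pi * \<i> * (- z)) = 1"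
      unfolding qprod_eq_0_iff mult_minus_right by blast
    then obtain m :: int where "of_nat (Suc n) * \<tau> + (- z) = of_int m"
      using exp_case by blast
    then show ?thesis
      by (intro exI[of _ "- m"] exI[of _ "int (Suc n)"]) (simp add: algebra_simps)
  qed
  then show "torus_point \<tau> z = torus_point \<tau> 0"
    by (simp add: torus_point_eq_iff)
qed

lemma theta1_diff_eq_0_iff: "theta1 \<tau> (z - w) = 0 \<longleftrightarrow> torus_point \<tau> z = torus_point \<tau> w"
  by (simp add: theta1_eq_0_iff torus_point_diff_eq_iff)

section \<open>Periodicity, harmonicity and limits of the potential\<close>

text \<open>The linear correction and the constant are what remains of the difference of the squares in the two
  Gaussian weights. The right-hand side shows the double periodicity.\<close>

lemma periodic_theta_potential_eq_theta_norm:
  assumes "torus_point \<tau> z \<noteq> torus_point \<tau> w" "torus_point \<tau> z \<noteq> torus_point \<tau> u"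
  shows "periodic_theta_potential \<tau> u w z =
    ln (theta_norm \<tau> (z - w)) - ln (theta_norm \<tau> (z - u)) - pi * (Im (w - u))\<^sup>2 / Im \<tau>"
proof -
  have nz: "theta1 \<tau> (z - w) \<noteq> 0" "theta1 \<tau> (z - u) \<noteq> 0"
    using assms by (simp_all add: theta1_diff_eq_0_iff)
  have "2 * pi * Im (w - u) * Im (z - w) / Im \<tau> =
      pi * (Im (z - u))\<^sup>2 / Im \<tau> - pi * (Im (z - w))\<^sup>2 / Im \<tau> - pi * (Im (w - u))\<^sup>2 / Im \<tau>"
    using Im_tau by (simp add: field_simps power2_eq_square)
  then show ?thesis
    using nz
    by (simp add: periodic_theta_potential_def theta_potential_def theta_norm_def norm_divide ln_mult ln_div)
qed

lemma periodic_theta_potential_cong: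
  assumes "torus_point \<tau> z = torus_point \<tau> z'"
    and "torus_point \<tau> z \<noteq> torus_point \<tau> w" "torus_point \<tau> z \<noteq> torus_point \<tau> u"
  shows "periodic_theta_potential \<tau> u w z = periodic_theta_potential \<tau> u w z'"
proof -
  have "torus_point \<tau> (z - a) = torus_point \<tau> (z' - a)" for a
    using assms(1) unfolding torus_point_eq_iff by (simp add: algebra_simps)
  then have "theta_norm \<tau> (z - a) = theta_norm \<tau> (z' - a)" for a
    by (rule theta_norm_cong)
  moreover have "torus_point \<tau> z' \<noteq> torus_point \<tau> w" "torus_point \<tau> z' \<noteq> torus_point \<tau> u"
    using assms(2,3) unfolding assms(1) .
  ultimately show ?thesis
    using assms(2,3) by (simp only: periodic_theta_potential_eq_theta_norm not_False_eq_True)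
qed

lemma harmonic_on_periodic_theta_potential:
  assumes S: "open S"
    and nz: "\<And>z. z \<in> S \<Longrightarrow> torus_point \<tau> z \<noteq> torus_point \<tau> w"
      "\<And>z. z \<in> S \<Longrightarrow> torus_point \<tau> z \<noteq> torus_point \<tau> u"
  shows "harmonic_on (periodic_theta_potential \<tau> u w) S"
proof (rule harmonic_on_cong)
  define c where "c = 2 * pi * Im (w - u) / Im \<tau>"
  \<comment> \<open>The linear correction is the logarithm of the modulus of an exponential.\<close>
  let ?F = "\<lambda>z. theta1 \<tau> (z - w) / theta1 \<tau> (z - u) * exp (- \<i> * of_real c * (z - w))"
  have theta: "theta1 \<tau> (z - w) \<noteq> 0" "theta1 \<tau> (z - u) \<noteq> 0" if "z \<in> S" for z
    using nz that by (simp_all add: theta1_diff_eq_0_iff)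
  show "harmonic_on (\<lambda>z. ln (cmod (?F z))) S"
    using theta by (intro harmonic_on_ln_cmod S holomorphic_intros theta1_holomorphic) auto
  show "ln (cmod (?F z)) = periodic_theta_potential \<tau> u w z" if "z \<in> S" for z
  proof -
    have "cmod (exp (- \<i> * of_real c * (z - w))) = exp (c * Im (z - w))"
      by simp
    then have "ln (cmod (?F z)) = theta_potential \<tau> u w z + c * Im (z - w)"
      using theta[OF that] unfolding norm_mult theta_potential_def by (subst ln_mult) auto
    then show ?thesis
      by (simp add: periodic_theta_potential_def c_def)
  qed
qed

lemma theta1_div_tendsto: "((\<lambda>t. theta1 \<tau> t / t) \<longlongrightarrow> 2 * of_real pi * dedekind_eta \<tau> ^ 3) (at 0)"
  using theta1_has_field_derivative_0 by (simp add: has_field_derivative_iff theta1_0)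

lemma ln_theta1_tendsto:
  "((\<lambda>t. ln (cmod (theta1 \<tau> t)) - ln (cmod t)) \<longlongrightarrow> ln (2 * pi * cmod (dedekind_eta \<tau>) ^ 3)) (at 0)"
proof -
  have nz: "2 * of_real pi * dedekind_eta \<tau> ^ 3 \<noteq> 0"
    using dedekind_eta_nonzero by simp
  have "((\<lambda>t. ln (cmod (theta1 \<tau> t / t))) \<longlongrightarrow> ln (cmod (2 * of_real pi * dedekind_eta \<tau> ^ 3))) (at 0)"
    using theta1_div_tendsto nz by (intro tendsto_intros) auto
  moreover have "\<forall>\<^sub>F t in at 0. ln (cmod (theta1 \<tau> t / t)) = ln (cmod (theta1 \<tau> t)) - ln (cmod t)"
    using tendsto_imp_eventually_ne[OF theta1_div_tendsto nz]
    by eventually_elim (auto simp: norm_divide ln_div)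
  ultimately show ?thesis
    by (simp add: norm_mult norm_power tendsto_cong)
qed

lemma eventually_theta1_nonzero: "\<forall>\<^sub>F t in at 0. theta1 \<tau> t \<noteq> 0"
proof -
  have "\<forall>\<^sub>F t in at 0. theta1 \<tau> t / t \<noteq> 0"
    using dedekind_eta_nonzero by (intro tendsto_imp_eventually_ne[OF theta1_div_tendsto]) simp
  then show ?thesis
    by eventually_elim auto
qed

text \<open>Pole and argument may both vary along \<open>F\<close>: the limit at a fixed pole and the limit at a fixed point,
  with the pole approaching it, are both instances.\<close>

lemma theta_potential_tendsto:
  fixes w z :: "'b \<Rightarrow> complex"
  assumes a: "torus_point \<tau> a \<noteq> torus_point \<tau> u"
    and lim: "filterlim (\<lambda>x. z x - w x) (at 0) F" "(z \<longlongrightarrow> a) F"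
  shows "((\<lambda>x. theta_potential \<tau> u (w x) (z x) - ln (cmod (z x - w x))) \<longlongrightarrow>
           ln (2 * pi * cmod (dedekind_eta \<tau>) ^ 3 / cmod (theta1 \<tau> (a - u)))) F"
proof -
  have nz: "theta1 \<tau> (a - u) \<noteq> 0"
    using a by (simp add: theta1_diff_eq_0_iff)
  have den: "((\<lambda>x. theta1 \<tau> (z x - u)) \<longlongrightarrow> theta1 \<tau> (a - u)) F"
    by (intro theta1_tendsto tendsto_intros lim)
  have "((\<lambda>x. (ln (cmod (theta1 \<tau> (z x - w x))) - ln (cmod (z x - w x))) - ln (cmod (theta1 \<tau> (z x - u)))) \<longlongrightarrow>
           ln (2 * pi * cmod (dedekind_eta \<tau>) ^ 3) - ln (cmod (theta1 \<tau> (a - u)))) F"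
    by (intro tendsto_diff filterlim_compose[OF ln_theta1_tendsto lim(1)] tendsto_ln tendsto_norm den)
       (use nz in auto)
  moreover have "\<forall>\<^sub>F x in F. (ln (cmod (theta1 \<tau> (z x - w x))) - ln (cmod (z x - w x))) - ln (cmod (theta1 \<tau> (z x - u)))
      = theta_potential \<tau> u (w x) (z x) - ln (cmod (z x - w x))"
    using eventually_compose_filterlim[OF eventually_theta1_nonzero lim(1)] tendsto_imp_eventually_ne[OF den nz]
    by eventually_elim (simp add: theta_potential_def norm_divide ln_div)
  moreover have "ln (2 * pi * cmod (dedekind_eta \<tau>) ^ 3 / cmod (theta1 \<tau> (a - u))) =
      ln (2 * pi * cmod (dedekind_eta \<tau>) ^ 3) - ln (cmod (theta1 \<tau> (a - u)))"
    using nz dedekind_eta_nonzero by (simp add: ln_div)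
  ultimately show ?thesis
    by (simp add: tendsto_cong)
qed

text \<open>The linear correction tends to \<open>0\<close>, as the argument approaches the pole.\<close>

lemma periodic_theta_potential_tendsto:
  fixes w z :: "'b \<Rightarrow> complex"
  assumes "torus_point \<tau> a \<noteq> torus_point \<tau> u"
    and lim: "filterlim (\<lambda>x. z x - w x) (at 0) F" "(z \<longlongrightarrow> a) F"
  shows "((\<lambda>x. periodic_theta_potential \<tau> u (w x) (z x) - ln (cmod (z x - w x))) \<longlongrightarrow>
           ln (2 * pi * cmod (dedekind_eta \<tau>) ^ 3 / cmod (theta1 \<tau> (a - u)))) F"
proof -
  have zw: "((\<lambda>x. z x - w x) \<longlongrightarrow> 0) F"
    using lim(1) by (simp add: filterlim_at)
  have "(w \<longlongrightarrow> a) F"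
    using tendsto_diff[OF lim(2) zw] by simp
  then have "((\<lambda>x. 2 * pi * Im (w x - u) * Im (z x - w x) / Im \<tau>) \<longlongrightarrow> 2 * pi * Im (a - u) * Im 0 / Im \<tau>) F"
    using Im_tau by (intro tendsto_intros zw) auto
  from tendsto_add[OF theta_potential_tendsto[OF assms] this] show ?thesis
    by (simp add: periodic_theta_potential_def algebra_simps)
qed

text \<open>The denominator \<open>theta1 \<tau> (z - u)\<close> tends to \<open>0\<close> while the numerator stays away from it.\<close>

lemma periodic_theta_potential_at_top:
  assumes "torus_point \<tau> w \<noteq> torus_point \<tau> u"
  shows "filterlim (periodic_theta_potential \<tau> u w) at_top (at u)"
proof -
  have nz: "theta1 \<tau> (u - w) \<noteq> 0"
    using assms by (simp add: theta1_diff_eq_0_iff)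
  have num: "((\<lambda>z. theta1 \<tau> (z - w)) \<longlongrightarrow> theta1 \<tau> (u - w)) (at u)"
    by (intro theta1_tendsto tendsto_intros)
  have "((\<lambda>z. theta1 \<tau> (z - u)) \<longlongrightarrow> theta1 \<tau> (u - u)) (at u)"
    by (intro theta1_tendsto tendsto_intros)
  then have "filterlim (\<lambda>z. cmod (theta1 \<tau> (z - u))) (at_right 0) (at u)"
    using eventually_compose_filterlim[OF eventually_theta1_nonzero filterlim_diff_at]
    by (simp add: filterlim_at theta1_0 tendsto_norm_zero)
  then have "filterlim (\<lambda>z. ln (cmod (theta1 \<tau> (z - u)))) at_bot (at u)"
    by (rule filterlim_compose[OF ln_at_0])
  then have "filterlim (\<lambda>z. - ln (cmod (theta1 \<tau> (z - u)))) at_top (at u)"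
    by (simp add: filterlim_uminus_at_bot)
  moreover have "((\<lambda>z. ln (cmod (theta1 \<tau> (z - w))) + 2 * pi * Im (w - u) * Im (z - w) / Im \<tau>)
       \<longlongrightarrow> ln (cmod (theta1 \<tau> (u - w))) + 2 * pi * Im (w - u) * Im (u - w) / Im \<tau>) (at u)"
    using nz Im_tau by (intro tendsto_intros num) auto
  ultimately have "filterlim (\<lambda>z. (ln (cmod (theta1 \<tau> (z - w))) + 2 * pi * Im (w - u) * Im (z - w) / Im \<tau>)
       + - ln (cmod (theta1 \<tau> (z - u)))) at_top (at u)"
    using filterlim_tendsto_add_at_top by blast
  moreover have "\<forall>\<^sub>F z in at u. (ln (cmod (theta1 \<tau> (z - w))) + 2 * pi * Im (w - u) * Im (z - w) / Im \<tau>)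
       + - ln (cmod (theta1 \<tau> (z - u))) = periodic_theta_potential \<tau> u w z"
    using eventually_compose_filterlim[OF eventually_theta1_nonzero filterlim_diff_at] tendsto_imp_eventually_ne[OF num nz]
    by eventually_elim (simp add: periodic_theta_potential_def theta_potential_def norm_divide ln_div)
  ultimately show ?thesis
    by (rule filterlim_mono_eventually[OF _ order_refl order_refl])
qed

section \<open>The punctured torus as an open Riemann surface\<close>

lemma Hausdorff_space_torus: "Hausdorff_space (torus \<tau>)"
  unfolding Hausdorff_space_def
proof (intro allI impI)
  fix x y assume "x \<in> topspace (torus \<tau>) \<and> y \<in> topspace (torus \<tau>) \<and> x \<noteq> y"
  then obtain z w where xy: "x = torus_point \<tau> z" "y = torus_point \<tau> w" "torus_point \<tau> z \<noteq> torus_point \<tau> w"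
    by (auto simp: topspace_torus)
  \<comment> \<open>Equivalence of two points is the closed condition \<open>theta1 \<tau> (z - w) = 0\<close>.\<close>
  define S where "S = {p. theta1 \<tau> (fst p - snd p) \<noteq> 0}"
  have "open S"
    unfolding S_def
    by (intro open_Collect_neq theta1_continuous continuous_intros)
  moreover have "(z, w) \<in> S"
    using xy(3) by (simp add: S_def theta1_diff_eq_0_iff)
  ultimately obtain A B where AB: "open A" "open B" "z \<in> A" "w \<in> B" "A \<times> B \<subseteq> S"
    by (rule open_prod_elim) auto
  have "disjnt (torus_point \<tau> ` A) (torus_point \<tau> ` B)"
    using AB(5) by (force simp: disjnt_def S_def theta1_diff_eq_0_iff)
  then show "\<exists>U V. openin (torus \<tau>) U \<and> openin (torus \<tau>) V \<and> x \<in> U \<and> y \<in> V \<and> disjnt U V"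
    using AB xy open_map_torus_point[of \<tau>] unfolding open_map_def by (metis imageI open_openin)
qed

lemma compact_space_torus: "compact_space (torus \<tau>)"
proof -
  \<comment> \<open>The closed fundamental parallelogram.\<close>
  define P where "P = (\<lambda>(s, t). complex_of_real s + of_real t * \<tau>) ` ({0..1} \<times> {0..1})"
  have "compact P"
    unfolding P_def case_prod_beta by (intro compact_continuous_image continuous_intros compact_Times) auto
  then have "compactin (torus \<tau>) (torus_point \<tau> ` P)"
    using image_compactin[OF _ continuous_map_torus_point] by simp
  moreover have "torus_point \<tau> z \<in> torus_point \<tau> ` P" for z
  proof -
    define t where "t = Im z / Im \<tau>"
    define s where "s = Re z - t * Re \<tau>"
    have "z = of_real s + of_real t * \<tau>"
      using Im_tau by (simp add: complex_eq_iff s_def t_def)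
    then have "z = (of_real (frac s) + of_real (frac t) * \<tau>) + of_int \<lfloor>s\<rfloor> + of_int \<lfloor>t\<rfloor> * \<tau>"
      by (simp add: frac_def algebra_simps)
    then have "torus_point \<tau> z = torus_point \<tau> (of_real (frac s) + of_real (frac t) * \<tau>)"
      unfolding torus_point_eq_iff by blast
    moreover have "of_real (frac s) + of_real (frac t) * \<tau> \<in> P"
      unfolding P_def by (intro image_eqI[of _ _ "(frac s, frac t)"]) (auto simp: less_imp_le[OF frac_lt_1])
    ultimately show ?thesis
      by blast
  qed
  then have "torus_point \<tau> ` P = topspace (torus \<tau>)"
    by (auto simp: topspace_torus)
  ultimately show ?thesis
    by (simp add: compact_space_def)
qed

lemma openin_punctured_torus:
  "openin (punctured_torus \<tau> u) U \<longleftrightarrow> openin (torus \<tau>) U \<and> torus_point \<tau> u \<notin> U"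
proof -
  have "closedin (torus \<tau>) {torus_point \<tau> u}"
    using Hausdorff_space_torus by (intro closedin_Hausdorff_singleton) (auto simp: topspace_torus)
  then have "openin (torus \<tau>) (topspace (torus \<tau>) - {torus_point \<tau> u})"
    by blast
  then show ?thesis
    unfolding punctured_torus_def using openin_subset by (auto simp: openin_open_subtopology)
qed

lemma Hausdorff_space_punctured_torus: "Hausdorff_space (punctured_torus \<tau> u)"
  unfolding punctured_torus_def by (intro Hausdorff_space_subtopology Hausdorff_space_torus)

lemma openin_punctured_torus_image:
  assumes "open W" "\<And>z. z \<in> W \<Longrightarrow> torus_point \<tau> z \<noteq> torus_point \<tau> u"
  shows "openin (punctured_torus \<tau> u) (torus_point \<tau> ` W)"
  unfolding openin_punctured_torus
proof
  show "openin (torus \<tau>) (torus_point \<tau> ` W)"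
    using assms(1) open_map_torus_point[of \<tau>] by (simp add: open_map_def)
  show "torus_point \<tau> u \<notin> torus_point \<tau> ` W"
    using assms(2) by (metis imageE)
qed

lemma eventually_torus_point_neq: "\<forall>\<^sub>F z in at u. torus_point \<tau> z \<noteq> torus_point \<tau> u"
  using eventually_compose_filterlim[OF eventually_theta1_nonzero filterlim_diff_at, of u]
  by (simp add: theta1_diff_eq_0_iff)

text \<open>If it were compact, it would be closed in the torus, so that the puncture alone would be an open set;
  but its preimage, a translate of the lattice, is discrete.\<close>

lemma not_compact_punctured_torus: "\<not> compact_space (punctured_torus \<tau> u)"
proof
  assume "compact_space (punctured_torus \<tau> u)"
  then have "compactin (torus \<tau>) (topspace (torus \<tau>) - {torus_point \<tau> u})"
    unfolding punctured_torus_def by (simp add: compact_space_subtopology compactin_subspace)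
  then have "closedin (torus \<tau>) (topspace (torus \<tau>) - {torus_point \<tau> u})"
    by (rule compactin_imp_closedin[OF Hausdorff_space_torus])
  then have "openin (torus \<tau>) (topspace (torus \<tau>) - (topspace (torus \<tau>) - {torus_point \<tau> u}))"
    by blast
  also have "topspace (torus \<tau>) - (topspace (torus \<tau>) - {torus_point \<tau> u}) = {torus_point \<tau> u}"
    by (auto simp: topspace_torus)
  finally have "open (torus_point \<tau> -` {torus_point \<tau> u})"
    by (simp add: openin_torus)
  then have "\<forall>\<^sub>F z in at u. z \<in> torus_point \<tau> -` {torus_point \<tau> u}"
    by (intro eventually_at_in_open') auto
  with eventually_torus_point_neq have "\<forall>\<^sub>F z in at u. False"
    by eventually_elim auto
  then show False
    by simp
qed

text \<open>The plane remains connected after removing the countably many points over the puncture.\<close>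

lemma connected_space_punctured_torus: "connected_space (punctured_torus \<tau> u)"
proof -
  have "{z. torus_point \<tau> z = torus_point \<tau> u} = (\<lambda>(m, n). u + of_int m + of_int n * \<tau>) ` UNIV"
    by (auto simp: torus_point_eq_iff)
  then have "countable {z. torus_point \<tau> z = torus_point \<tau> u}"
    by simp
  then have "connected (UNIV - {z. torus_point \<tau> z = torus_point \<tau> u})"
    by (intro connected_open_diff_countable) auto
  then have "connectedin (torus \<tau>) (torus_point \<tau> ` (UNIV - {z. torus_point \<tau> z = torus_point \<tau> u}))"
    by (intro connectedin_continuous_map_image[OF continuous_map_torus_point]) simp
  also have "torus_point \<tau> ` (UNIV - {z. torus_point \<tau> z = torus_point \<tau> u}) = topspace (torus \<tau>) - {torus_point \<tau> u}"
    by (auto simp: topspace_torus)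
  finally show ?thesis
    by (simp add: connectedin_def punctured_torus_def)
qed

lemma torus_chart_homeomorphic:
  assumes "(U, \<phi>) \<in> torus_atlas \<tau> u"
  shows "homeomorphic_map (subtopology (punctured_torus \<tau> u) U) (top_of_set (\<phi> ` U)) \<phi>"
proof -
  let ?X = "subtopology (punctured_torus \<tau> u) U"
  obtain W where W: "open W" "inj_on (torus_point \<tau>) W" "U = torus_point \<tau> ` W"
    "\<And>z. z \<in> W \<Longrightarrow> torus_point \<tau> z \<noteq> torus_point \<tau> u"
    "\<And>z. z \<in> W \<Longrightarrow> \<phi> (torus_point \<tau> z) = z"
    using assms by (rule torus_atlasE) blast
  have \<phi>U: "\<phi> ` U = W"
    using W(5) by (simp add: W(3) image_image)
  have U: "openin (torus \<tau>) U"
    using W(1,3) open_map_torus_point[of \<tau>] by (simp add: open_map_def)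
  have sub: "?X = subtopology (torus \<tau>) U"
  proof -
    have "(topspace (torus \<tau>) - {torus_point \<tau> u}) \<inter> U = U"
      using W(3,4) by (auto simp: topspace_torus)
    then show ?thesis
      unfolding punctured_torus_def subtopology_subtopology by (simp only:)
  qed
  have "homeomorphic_map (top_of_set W) ?X (torus_point \<tau>)"
  proof (rule bijective_open_imp_homeomorphic_map)
    show "continuous_map (top_of_set W) ?X (torus_point \<tau>)"
      using W(3) unfolding sub
      by (auto simp: continuous_map_in_subtopology intro: continuous_map_from_subtopology continuous_map_torus_point)
    show "open_map (top_of_set W) ?X (torus_point \<tau>)"
      using open_map_torus_point[of \<tau>]
      unfolding sub open_map_def openin_open_subtopology[OF U] openin_open_eq[OF W(1)]
      by (auto simp: W(3))
    show "torus_point \<tau> ` topspace (top_of_set W) = topspace ?X"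
      using W(3) openin_subset[OF U] unfolding sub by auto
    show "inj_on (torus_point \<tau>) (topspace (top_of_set W))"
      using W(2) by simp
  qed
  then obtain g where "homeomorphic_maps (top_of_set W) ?X (torus_point \<tau>) g"
    by (auto simp: homeomorphic_map_maps)
  then have g: "homeomorphic_map ?X (top_of_set W) g" "\<And>z. z \<in> W \<Longrightarrow> g (torus_point \<tau> z) = z"
    by (auto simp: homeomorphic_maps_map)
  have "g p = \<phi> p" if "p \<in> topspace ?X" for p
    using that g(2) W(3,5) by auto
  with g(1) show ?thesis
    unfolding \<phi>U by (rule homeomorphic_map_eq)
qed

lemma open_riemann_surface_punctured_torus:
  "open_riemann_surface (punctured_torus \<tau> u) (torus_atlas \<tau> u)"
  unfolding open_riemann_surface_def
proof (intro conjI)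
  have chart: "\<exists>W. open W \<and> z \<in> W \<and> inj_on (torus_point \<tau>) W \<and> torus_point \<tau> u \<notin> torus_point \<tau> ` W"
    if z: "torus_point \<tau> z \<noteq> torus_point \<tau> u" for z
  proof -
    obtain e where e: "e > 0" "\<And>t. t \<noteq> 0 \<Longrightarrow> dist t 0 < e \<Longrightarrow> theta1 \<tau> t \<noteq> 0"
      using eventually_theta1_nonzero by (auto simp: eventually_at)
    \<comment> \<open>Two points of a ball of radius \<open>e / 2\<close> differ by less than \<open>e\<close>, hence not by a nonzero lattice point.\<close>
    define W where "W = ball z (e / 2) \<inter> {y. theta1 \<tau> (y - u) \<noteq> 0}"
    have "open W"
      unfolding W_def
      by (intro open_Int open_ball open_Collect_neq theta1_continuous continuous_intros)
    moreover have "z \<in> W"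
      using z e(1) by (simp add: W_def theta1_diff_eq_0_iff)
    moreover have "inj_on (torus_point \<tau>) W"
    proof
      fix x y assume xy: "x \<in> W" "y \<in> W" "torus_point \<tau> x = torus_point \<tau> y"
      have "dist (x - y) 0 < e"
        using xy(1,2) dist_triangle_half_r[of z x e y] by (simp add: W_def dist_norm)
      then show "x = y"
        using e(2)[of "x - y"] xy(3) by (auto simp: theta1_diff_eq_0_iff)
    qed
    moreover have "torus_point \<tau> u \<notin> torus_point \<tau> ` W"
      unfolding W_def theta1_diff_eq_0_iff by (auto simp: image_iff)
    ultimately show ?thesis
      by blast
  qed
  show "(\<Union>(U, \<phi>)\<in>torus_atlas \<tau> u. U) = topspace (punctured_torus \<tau> u)"
  proof (intro equalityI subsetI)
    fix p assume "p \<in> (\<Union>(U, \<phi>)\<in>torus_atlas \<tau> u. U)"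
    then obtain U \<phi> where U: "(U, \<phi>) \<in> torus_atlas \<tau> u" "p \<in> U"
      by blast
    from U(1) obtain W where "U = torus_point \<tau> ` W" "\<And>z. z \<in> W \<Longrightarrow> torus_point \<tau> z \<noteq> torus_point \<tau> u"
      by (rule torus_atlasE) blast
    with U(2) show "p \<in> topspace (punctured_torus \<tau> u)"
      by (auto simp: torus_point_mem_punctured_torus)
  next
    fix p assume "p \<in> topspace (punctured_torus \<tau> u)"
    then obtain z where z: "p = torus_point \<tau> z" "torus_point \<tau> z \<noteq> torus_point \<tau> u"
      by (auto simp: topspace_punctured_torus)
    from chart[OF z(2)] obtain W where W: "open W" "z \<in> W" "inj_on (torus_point \<tau>) W"
      "torus_point \<tau> u \<notin> torus_point \<tau> ` W"
      by blast
    then have "(torus_point \<tau> ` W, inv_into W (torus_point \<tau>)) \<in> torus_atlas \<tau> u"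
      by (simp only: torus_atlas_def) blast
    then show "p \<in> (\<Union>(U, \<phi>)\<in>torus_atlas \<tau> u. U)"
      using W(2) z(1) by (intro UN_I[of "(torus_point \<tau> ` W, inv_into W (torus_point \<tau>))"]) auto
  qed
  have "\<forall>\<^sub>F z in at u. torus_point \<tau> z \<in> topspace (punctured_torus \<tau> u)"
    using eventually_torus_point_neq by (simp add: torus_point_mem_punctured_torus)
  then show "topspace (punctured_torus \<tau> u) \<noteq> {}"
    using eventually_happens by fastforce
  show "\<forall>(U, \<phi>)\<in>torus_atlas \<tau> u. openin (punctured_torus \<tau> u) U \<and> open (\<phi> ` U) \<and>
      homeomorphic_map (subtopology (punctured_torus \<tau> u) U) (top_of_set (\<phi> ` U)) \<phi>"
  proof (safe)
    fix U \<phi> assume *: "(U, \<phi>) \<in> torus_atlas \<tau> u"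
    obtain W where W: "open W" "U = torus_point \<tau> ` W"
      "\<And>z. z \<in> W \<Longrightarrow> torus_point \<tau> z \<noteq> torus_point \<tau> u"
      "\<And>z. z \<in> W \<Longrightarrow> \<phi> (torus_point \<tau> z) = z"
      using * by (rule torus_atlasE) blast
    show "openin (punctured_torus \<tau> u) U"
      using W(1-3) by (simp add: openin_punctured_torus_image)
    have "\<phi> ` U = W"
      using W(4) by (simp add: W(2) image_image)
    then show "open (\<phi> ` U)"
      using W(1) by simp
    show "homeomorphic_map (subtopology (punctured_torus \<tau> u) U) (top_of_set (\<phi> ` U)) \<phi>"
      using * by (rule torus_chart_homeomorphic)
  qed
  show "\<forall>(U, \<phi>)\<in>torus_atlas \<tau> u. \<forall>(V, \<psi>)\<in>torus_atlas \<tau> u.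
      (\<psi> \<circ> inv_into U \<phi>) holomorphic_on \<phi> ` (U \<inter> V)"
    using torus_transition_holomorphic by blast
qed (rule connected_space_punctured_torus Hausdorff_space_punctured_torus not_compact_punctured_torus)+

text \<open>This transports limits at a point of the surface to limits in the plane.\<close>

lemma torus_chart_filterlim:
  assumes "(U, \<phi>) \<in> torus_atlas \<tau> u" "p \<in> U"
  shows "filterlim \<phi> (at (\<phi> p)) (atin (punctured_torus \<tau> u) p)"
    and "\<forall>\<^sub>F x in atin (punctured_torus \<tau> u) p. x \<in> U - {p}"
proof -
  obtain W where W: "open W" "U = torus_point \<tau> ` W"
    "\<And>z. z \<in> W \<Longrightarrow> torus_point \<tau> z \<noteq> torus_point \<tau> u"
    "\<And>z. z \<in> W \<Longrightarrow> \<phi> (torus_point \<tau> z) = z"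
    using assms(1) by (rule torus_atlasE) blast
  obtain a where a: "a \<in> W" "p = torus_point \<tau> a"
    using assms(2) W(2) by blast
  show "filterlim \<phi> (at (\<phi> p)) (atin (punctured_torus \<tau> u) p)"
    unfolding filterlim_iff
  proof (intro allI impI)
    fix P assume "eventually P (at (\<phi> p))"
    then obtain S where S: "open S" "a \<in> S" "\<And>z. z \<in> S \<Longrightarrow> z \<noteq> a \<Longrightarrow> P z"
      using a W(4) by (auto simp: eventually_at_topological)
    have "openin (punctured_torus \<tau> u) (torus_point \<tau> ` (S \<inter> W))"
      using S(1) W(1,3) by (intro openin_punctured_torus_image) auto
    moreover have "P (\<phi> x)" if "x \<in> torus_point \<tau> ` (S \<inter> W) - {p}" for x
    proof -
      obtain y where y: "y \<in> S" "y \<in> W" "x = torus_point \<tau> y" "y \<noteq> a"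
        using \<open>x \<in> torus_point \<tau> ` (S \<inter> W) - {p}\<close> a(2) by blast
      then show ?thesis
        using W(4) S(3) by simp
    qed
    ultimately show "\<forall>\<^sub>F x in atin (punctured_torus \<tau> u) p. P (\<phi> x)"
      unfolding eventually_atin using a S(2) by blast
  qed
  show "\<forall>\<^sub>F x in atin (punctured_torus \<tau> u) p. x \<in> U - {p}"
    unfolding eventually_atin using openin_punctured_torus_image[of W u] W assms(2) by blast
qed

section \<open>Evans-Selberg potentials and the fundamental metric\<close>

lemma torus_potential_torus_point:
  assumes "torus_point \<tau> z \<noteq> torus_point \<tau> w" "torus_point \<tau> z \<noteq> torus_point \<tau> u"
  shows "torus_potential \<tau> u w (torus_point \<tau> z) = periodic_theta_potential \<tau> u w z"
proof -
  have "torus_point \<tau> (inv (torus_point \<tau>) (torus_point \<tau> z)) = torus_point \<tau> z"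
    by (simp add: f_inv_into_f)
  then show ?thesis
    unfolding torus_potential_def using assms by (intro periodic_theta_potential_cong) auto
qed

text \<open>As the torus is compact, the complements of the discs around the puncture are compact, so approaching
  the ideal boundary means approaching the puncture.\<close>

lemma torus_potential_ideal_boundary:
  assumes w: "torus_point \<tau> w \<noteq> torus_point \<tau> u"
  shows "filterlim (\<lambda>x. torus_potential \<tau> u w (the x)) at_top
           (atin (Alexandroff_compactification (punctured_torus \<tau> u)) None)"
  unfolding filterlim_at_top
proof
  fix K :: real
  let ?X = "punctured_torus \<tau> u"
  have "\<forall>\<^sub>F z in at u. K \<le> periodic_theta_potential \<tau> u w z"
    using periodic_theta_potential_at_top[OF w] by (simp add: filterlim_at_top)
  moreover have "\<forall>\<^sub>F z in at u. theta1 \<tau> (z - w) \<noteq> 0"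
  proof (rule tendsto_imp_eventually_ne)
    show "((\<lambda>z. theta1 \<tau> (z - w)) \<longlongrightarrow> theta1 \<tau> (u - w)) (at u)"
      by (intro theta1_tendsto tendsto_intros)
    show "theta1 \<tau> (u - w) \<noteq> 0"
      using w by (simp add: theta1_diff_eq_0_iff)
  qed
  ultimately have "\<forall>\<^sub>F z in at u. K \<le> periodic_theta_potential \<tau> u w z \<and> torus_point \<tau> z \<noteq> torus_point \<tau> w"
    by eventually_elim (simp add: theta1_diff_eq_0_iff)
  then obtain D where D: "open D" "u \<in> D"
    "\<And>z. z \<in> D \<Longrightarrow> z \<noteq> u \<Longrightarrow> K \<le> periodic_theta_potential \<tau> u w z \<and> torus_point \<tau> z \<noteq> torus_point \<tau> w"
    by (auto simp: eventually_at_topological)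
  define C where "C = topspace (torus \<tau>) - torus_point \<tau> ` D"
  have "openin (torus \<tau>) (torus_point \<tau> ` D)"
    using D(1) open_map_torus_point[of \<tau>] by (simp add: open_map_def)
  then have "closedin (torus \<tau>) C"
    unfolding C_def by blast
  then have "compactin (torus \<tau>) C"
    by (rule closedin_compact_space[OF compact_space_torus])
  then have C: "compactin ?X C"
    using D(2) by (auto simp: punctured_torus_def compactin_subtopology C_def)
  then have "closedin ?X C"
    by (rule compactin_imp_closedin[OF Hausdorff_space_punctured_torus])
  with C have "openin (Alexandroff_compactification ?X) (insert None (Some ` (topspace ?X - C)))"
    unfolding openin_Alexandroff_compactification by blast
  moreover have "K \<le> torus_potential \<tau> u w (the x)"
    if x: "x \<in> insert None (Some ` (topspace ?X - C)) - {None}" for x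
  proof -
    obtain p where p: "x = Some p" "p \<in> topspace ?X" "p \<notin> C"
      using x by auto
    then obtain z where z: "z \<in> D" "p = torus_point \<tau> z"
      by (auto simp: C_def punctured_torus_def)
    then have "torus_point \<tau> z \<noteq> torus_point \<tau> u"
      using p(2) by (simp add: torus_point_mem_punctured_torus)
    moreover from this have "K \<le> periodic_theta_potential \<tau> u w z" "torus_point \<tau> z \<noteq> torus_point \<tau> w"
      using D(3) z(1) by auto
    ultimately show ?thesis
      using p(1) z(2) by (simp add: torus_potential_torus_point)
  qed
  ultimately show "\<forall>\<^sub>F x in atin (Alexandroff_compactification ?X) None. K \<le> torus_potential \<tau> u w (the x)"
    unfolding eventually_atin by blast
qed

lemma torus_potential_pole:
  assumes U: "(U, \<phi>) \<in> torus_atlas \<tau> u" and p: "torus_point \<tau> w \<in> U"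
  shows "\<exists>M. \<forall>\<^sub>F p in atin (punctured_torus \<tau> u) (torus_point \<tau> w).
    \<bar>torus_potential \<tau> u w p - ln (cmod (\<phi> p - \<phi> (torus_point \<tau> w)))\<bar> \<le> M"
proof -
  let ?p = "torus_point \<tau> w" and ?F = "atin (punctured_torus \<tau> u) (torus_point \<tau> w)"
  obtain W where W: "U = torus_point \<tau> ` W"
    "\<And>z. z \<in> W \<Longrightarrow> torus_point \<tau> z \<noteq> torus_point \<tau> u"
    "\<And>z. z \<in> W \<Longrightarrow> \<phi> (torus_point \<tau> z) = z"
    using U by (rule torus_atlasE) blast
  have w: "torus_point \<tau> w \<noteq> torus_point \<tau> u"
    using p W by auto
  \<comment> \<open>The chart may lift the pole to another representative than \<open>w\<close>; translating by their
    difference, a lattice point, gives a lift \<open>z\<close> of the points near the pole that tends to \<open>w\<close>.\<close>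
  define z where "z x = \<phi> x + (w - \<phi> ?p)" for x
  have \<phi>: "torus_point \<tau> (\<phi> x) = x" if "x \<in> U" for x
    using that W by auto
  have z: "torus_point \<tau> (z x) = x" if "x \<in> U" for x
  proof -
    have "torus_point \<tau> (z x) = torus_point \<tau> (\<phi> x)"
      using \<phi>[OF p] unfolding z_def torus_point_eq_iff[of _ w] eq_commute[of "torus_point \<tau> (\<phi> ?p)"]
      by (simp add: torus_point_eq_iff algebra_simps)
    with \<phi>[OF that] show ?thesis
      by simp
  qed
  have chart: "filterlim \<phi> (at (\<phi> ?p)) ?F" and ev: "\<forall>\<^sub>F x in ?F. x \<in> U - {?p}"
    using torus_chart_filterlim[OF U p] by auto
  from chart have "filterlim (\<lambda>x. z x - w) (at 0) ?F"
    by (auto simp: filterlim_at z_def LIM_zero_iff)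
  moreover from chart have "((\<lambda>x. \<phi> x + (w - \<phi> ?p)) \<longlongrightarrow> \<phi> ?p + (w - \<phi> ?p)) ?F"
    by (intro tendsto_intros) (simp add: filterlim_at)
  then have "(z \<longlongrightarrow> w) ?F"
    by (simp add: z_def[abs_def])
  ultimately have "((\<lambda>x. periodic_theta_potential \<tau> u w (z x) - ln (cmod (z x - w))) \<longlongrightarrow>
           ln (2 * pi * cmod (dedekind_eta \<tau>) ^ 3 / cmod (theta1 \<tau> (w - u)))) ?F"
    by (intro periodic_theta_potential_tendsto[OF w])
  then obtain l where "((\<lambda>x. periodic_theta_potential \<tau> u w (z x) - ln (cmod (z x - w))) \<longlongrightarrow> l) ?F"
    by blast
  then have "\<forall>\<^sub>F x in ?F. dist (periodic_theta_potential \<tau> u w (z x) - ln (cmod (z x - w))) l < 1"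
    by (rule tendstoD) simp
  with ev have "\<forall>\<^sub>F x in ?F. \<bar>torus_potential \<tau> u w x - ln (cmod (\<phi> x - \<phi> ?p))\<bar> \<le> \<bar>l\<bar> + 1"
  proof eventually_elim
    case (elim x)
    then have x: "x \<in> U" "x \<noteq> ?p"
      by blast+
    have "x \<noteq> torus_point \<tau> u"
      using x(1) W(1,2) by blast
    with x(2) have "torus_potential \<tau> u w x = periodic_theta_potential \<tau> u w (z x)"
      using torus_potential_torus_point[of "z x" w u] unfolding z[OF x(1)] by blast
    then show ?case
      using elim by (simp add: z_def dist_real_def)
  qed
  then show ?thesis ..
qed

lemma evans_selberg_torus_potential:
  assumes w: "torus_point \<tau> w \<noteq> torus_point \<tau> u"
  shows "evans_selberg_potential (punctured_torus \<tau> u) (torus_atlas \<tau> u) (torus_point \<tau> w) (torus_potential \<tau> u w)"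
  unfolding evans_selberg_potential_def
proof (intro conjI)
  show "\<forall>(U, \<phi>)\<in>torus_atlas \<tau> u.
      harmonic_on (torus_potential \<tau> u w \<circ> inv_into U \<phi>) (\<phi> ` (U - {torus_point \<tau> w}))"
  proof (safe)
    fix U \<phi> assume "(U, \<phi>) \<in> torus_atlas \<tau> u"
    then obtain W where W: "open W" "U = torus_point \<tau> ` W"
      "\<And>z. z \<in> W \<Longrightarrow> torus_point \<tau> z \<noteq> torus_point \<tau> u"
      "\<And>z. z \<in> W \<Longrightarrow> \<phi> (torus_point \<tau> z) = z"
      "\<And>z. z \<in> W \<Longrightarrow> inv_into U \<phi> z = torus_point \<tau> z"
      by (rule torus_atlasE) blast
    define S where "S = W \<inter> {z. theta1 \<tau> (z - w) \<noteq> 0}"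
    have "U - {torus_point \<tau> w} = torus_point \<tau> ` S"
      by (auto simp: W(2) S_def theta1_diff_eq_0_iff)
    moreover have "\<phi> (torus_point \<tau> z) = z" if "z \<in> S" for z
      using that W(4) by (simp add: S_def)
    ultimately have S: "\<phi> ` (U - {torus_point \<tau> w}) = S"
      by (simp add: image_image)
    have "open S"
      unfolding S_def
      by (intro open_Int W(1) open_Collect_neq theta1_continuous continuous_intros)
    then have "harmonic_on (periodic_theta_potential \<tau> u w) S"
      using W(3) by (intro harmonic_on_periodic_theta_potential)
        (auto simp: S_def theta1_diff_eq_0_iff)
    then show "harmonic_on (torus_potential \<tau> u w \<circ> inv_into U \<phi>) (\<phi> ` (U - {torus_point \<tau> w}))"
      unfolding S
    proof (rule harmonic_on_cong)
      fix z assume "z \<in> S"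
      then show "periodic_theta_potential \<tau> u w z = (torus_potential \<tau> u w \<circ> inv_into U \<phi>) z"
        using W(3,5) by (simp add: S_def torus_potential_torus_point theta1_diff_eq_0_iff)
    qed
  qed
  show "open_riemann_surface (punctured_torus \<tau> u) (torus_atlas \<tau> u)"
    by (rule open_riemann_surface_punctured_torus)
  show "torus_point \<tau> w \<in> topspace (punctured_torus \<tau> u)"
    using w by (simp add: torus_point_mem_punctured_torus)
  show "filterlim (\<lambda>x. torus_potential \<tau> u w (the x)) at_top
      (atin (Alexandroff_compactification (punctured_torus \<tau> u)) None)"
    using w by (rule torus_potential_ideal_boundary)
  show "\<forall>(U, \<phi>)\<in>torus_atlas \<tau> u. torus_point \<tau> w \<in> U \<longrightarrow>
      (\<exists>M. \<forall>\<^sub>F p in atin (punctured_torus \<tau> u) (torus_point \<tau> w).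
        \<bar>torus_potential \<tau> u w p - ln (cmod (\<phi> p - \<phi> (torus_point \<tau> w)))\<bar> \<le> M)"
  proof (intro ballI, clarify)
    fix U \<phi> assume "(U, \<phi>) \<in> torus_atlas \<tau> u" "torus_point \<tau> w \<in> U"
    then show "\<exists>M. \<forall>\<^sub>F p in atin (punctured_torus \<tau> u) (torus_point \<tau> w).
        \<bar>torus_potential \<tau> u w p - ln (cmod (\<phi> p - \<phi> (torus_point \<tau> w)))\<bar> \<le> M"
      by (rule torus_potential_pole)
  qed
qed

text \<open>Here the pole varies and the argument is fixed; the chart turns the limit into one in the plane.\<close>

lemma torus_potential_fundamental_density:
  assumes U: "(U, \<phi>) \<in> torus_atlas \<tau> u" and p: "p \<in> U"
    and E: "\<And>p0. p0 \<in> U \<Longrightarrow> E p0 = torus_potential \<tau> u (\<phi> p0)"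
  shows "has_fundamental_density (punctured_torus \<tau> u) E \<phi> p
    (2 * pi * cmod (dedekind_eta \<tau>) ^ 3 / cmod (theta1 \<tau> (\<phi> p - u)))"
proof -
  let ?F = "atin (punctured_torus \<tau> u) p"
  obtain W where W: "U = torus_point \<tau> ` W"
    "\<And>z. z \<in> W \<Longrightarrow> torus_point \<tau> z \<noteq> torus_point \<tau> u"
    "\<And>z. z \<in> W \<Longrightarrow> \<phi> (torus_point \<tau> z) = z"
    using U by (rule torus_atlasE) blast
  have \<phi>: "torus_point \<tau> (\<phi> x) = x" if "x \<in> U" for x
    using that W by auto
  have u: "torus_point \<tau> (\<phi> p) \<noteq> torus_point \<tau> u"
    using p W by auto
  have chart: "filterlim \<phi> (at (\<phi> p)) ?F" and ev: "\<forall>\<^sub>F x in ?F. x \<in> U - {p}"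
    using torus_chart_filterlim[OF U p] by auto
  have "((\<lambda>x. \<phi> p - \<phi> x) \<longlongrightarrow> \<phi> p - \<phi> p) ?F"
    using chart by (intro tendsto_intros) (simp add: filterlim_at)
  moreover have "\<forall>\<^sub>F x in ?F. \<phi> p - \<phi> x \<noteq> 0"
    using chart by (auto simp: filterlim_at elim: eventually_mono)
  ultimately have "filterlim (\<lambda>x. \<phi> p - \<phi> x) (at 0) ?F"
    by (simp add: filterlim_at)
  then have "((\<lambda>x. periodic_theta_potential \<tau> u (\<phi> x) (\<phi> p) - ln (cmod (\<phi> p - \<phi> x))) \<longlongrightarrow>
      ln (2 * pi * cmod (dedekind_eta \<tau>) ^ 3 / cmod (theta1 \<tau> (\<phi> p - u)))) ?F"
    by (intro periodic_theta_potential_tendsto[OF u] tendsto_const)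
  moreover have "\<forall>\<^sub>F x in ?F. periodic_theta_potential \<tau> u (\<phi> x) (\<phi> p) = E x p"
    using ev
  proof eventually_elim
    case (elim x)
    then have "torus_point \<tau> (\<phi> p) \<noteq> torus_point \<tau> (\<phi> x)"
      using \<phi> p by auto
    from torus_potential_torus_point[OF this u] show ?case
      using elim E \<phi>[OF p] by simp
  qed
  then have "\<forall>\<^sub>F x in ?F. periodic_theta_potential \<tau> u (\<phi> x) (\<phi> p) - ln (cmod (\<phi> p - \<phi> x)) =
      E x p - ln (cmod (\<phi> p - \<phi> x))"
    by eventually_elim simp
  ultimately have "((\<lambda>x. E x p - ln (cmod (\<phi> p - \<phi> x))) \<longlongrightarrow>
      ln (2 * pi * cmod (dedekind_eta \<tau>) ^ 3 / cmod (theta1 \<tau> (\<phi> p - u)))) ?F"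
    by (rule Lim_transform_eventually)
  moreover have "2 * pi * cmod (dedekind_eta \<tau>) ^ 3 / cmod (theta1 \<tau> (\<phi> p - u)) > 0"
    using u dedekind_eta_nonzero by (simp add: theta1_diff_eq_0_iff)
  ultimately show ?thesis
    unfolding has_fundamental_density_def by (metis exp_ln)
qed

end

theorem corollary4p2:
  fixes \<tau> u :: complex
  assumes "Im \<tau> > 0"
  shows "(\<forall>w. torus_point \<tau> w \<in> topspace (punctured_torus \<tau> u) \<longrightarrow>
            (\<exists>l. ((\<lambda>z. theta_potential \<tau> u w z - ln (cmod (z - w))) \<longlongrightarrow> l) (at w) \<and>
                 exp l = 2 * pi * cmod (dedekind_eta \<tau>) ^ 3 / cmod (theta1 \<tau> (w - u)))) \<and>
         (\<forall>(U, \<phi>)\<in>torus_atlas \<tau> u. \<exists>E.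
            (\<forall>p0\<in>topspace (punctured_torus \<tau> u).
               evans_selberg_potential (punctured_torus \<tau> u) (torus_atlas \<tau> u) p0 (E p0)) \<and>
            (\<forall>p0\<in>U. \<forall>z. torus_point \<tau> z \<in> topspace (punctured_torus \<tau> u) - {p0} \<longrightarrow>
               E p0 (torus_point \<tau> z) = periodic_theta_potential \<tau> u (\<phi> p0) z) \<and>
            (\<forall>p\<in>U. has_fundamental_density (punctured_torus \<tau> u) E \<phi> p
               (2 * pi * cmod (dedekind_eta \<tau>) ^ 3 / cmod (theta1 \<tau> (\<phi> p - u)))))"
proof (rule conjI; safe)
  fix w assume "torus_point \<tau> w \<in> topspace (punctured_torus \<tau> u)"
  then have w: "torus_point \<tau> w \<noteq> torus_point \<tau> u"
    by (simp add: torus_point_mem_punctured_torus)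
  have "((\<lambda>z. theta_potential \<tau> u w z - ln (cmod (z - w))) \<longlongrightarrow>
      ln (2 * pi * cmod (dedekind_eta \<tau>) ^ 3 / cmod (theta1 \<tau> (w - u)))) (at w)"
    by (intro theta_potential_tendsto[OF assms w] filterlim_diff_at tendsto_ident_at)
  moreover have "2 * pi * cmod (dedekind_eta \<tau>) ^ 3 / cmod (theta1 \<tau> (w - u)) > 0"
    using w dedekind_eta_nonzero[OF assms] by (simp add: theta1_diff_eq_0_iff[OF assms])
  ultimately show "\<exists>l. ((\<lambda>z. theta_potential \<tau> u w z - ln (cmod (z - w))) \<longlongrightarrow> l) (at w) \<and>
      exp l = 2 * pi * cmod (dedekind_eta \<tau>) ^ 3 / cmod (theta1 \<tau> (w - u))"
    by (metis exp_ln)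
next
  fix U \<phi> assume U: "(U, \<phi>) \<in> torus_atlas \<tau> u"
  obtain W where W: "U = torus_point \<tau> ` W" "\<And>z. z \<in> W \<Longrightarrow> \<phi> (torus_point \<tau> z) = z"
    using U by (rule torus_atlasE) blast
  \<comment> \<open>The values prescribed on \<open>U\<close> use the representative of the pole given by the chart. Different
    representatives give potentials that differ by a constant, so at poles outside \<open>U\<close> any
    choice will do.\<close>
  define lift where "lift p = (if p \<in> U then \<phi> p else inv (torus_point \<tau>) p)" for p
  have lift: "torus_point \<tau> (lift p) = p" if "p \<in> topspace (punctured_torus \<tau> u)" for p
    using that W by (auto simp: lift_def topspace_punctured_torus f_inv_into_f)
  define E where "E p = torus_potential \<tau> u (lift p)" for p
  show "\<exists>E. (\<forall>p0\<in>topspace (punctured_torus \<tau> u).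
               evans_selberg_potential (punctured_torus \<tau> u) (torus_atlas \<tau> u) p0 (E p0)) \<and>
            (\<forall>p0\<in>U. \<forall>z. torus_point \<tau> z \<in> topspace (punctured_torus \<tau> u) - {p0} \<longrightarrow>
               E p0 (torus_point \<tau> z) = periodic_theta_potential \<tau> u (\<phi> p0) z) \<and>
            (\<forall>p\<in>U. has_fundamental_density (punctured_torus \<tau> u) E \<phi> p
               (2 * pi * cmod (dedekind_eta \<tau>) ^ 3 / cmod (theta1 \<tau> (\<phi> p - u))))"
  proof (intro exI[of _ E] conjI ballI allI impI)
    fix p0 assume p0: "p0 \<in> topspace (punctured_torus \<tau> u)"
    then have "torus_point \<tau> (lift p0) \<noteq> torus_point \<tau> u"
      using torus_point_mem_punctured_torus[of \<tau> "lift p0" u] by (simp only: lift not_False_eq_True)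
    from evans_selberg_torus_potential[OF assms this]
    show "evans_selberg_potential (punctured_torus \<tau> u) (torus_atlas \<tau> u) p0 (E p0)"
      by (simp add: E_def lift[OF p0])
  next
    fix p0 z assume p0: "p0 \<in> U" and z: "torus_point \<tau> z \<in> topspace (punctured_torus \<tau> u) - {p0}"
    have "torus_point \<tau> (\<phi> p0) = p0"
      using p0 W by auto
    then show "E p0 (torus_point \<tau> z) = periodic_theta_potential \<tau> u (\<phi> p0) z"
      using p0 z by (simp add: E_def lift_def torus_potential_torus_point[OF assms] torus_point_mem_punctured_torus)
  next
    fix p assume "p \<in> U"
    then show "has_fundamental_density (punctured_torus \<tau> u) E \<phi> p
       (2 * pi * cmod (dedekind_eta \<tau>) ^ 3 / cmod (theta1 \<tau> (\<phi> p - u)))"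
      by (intro torus_potential_fundamental_density[OF assms U]) (simp_all add: E_def lift_def)
  qed
qed

end
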